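(* Let $(\mathcal{A},\mathcal{B})$ be an abstract boundary control system satisfying Assumptions (A1), (A2), (A3) of the context, and let $D,t_0>0$, the transition signal $\varphi$ and the feedback gain $K$ be fixed as in the context. Then there exist constants $\kappa_0>0$ and $\overline{C}_1,\overline{C}_2,\overline{C}_3,\overline{C}_4\in\mathbb{R}_+$ such that, for any $X_0\in D(\mathcal{A}_0)$ and any $d\in\mathcal{C}^1(\mathbb{R}_+;\mathcal{H})$, the classical solution $X$ of the closed-loop system (CL) of the context associated with the initial condition $X_0$ and the distributed disturbance $d$ satisfies $$\Vert X(t)\Vert_{\mathcal{H}}\leq \overline{C}_1e^{-\kappa_0t}\Vert X_0\Vert_{\mathcal{H}}+\overline{C}_2\sup_{\tau\in[0,t]}\Vert d(\tau)\Vert_{\mathcal{H}},$$ and the associated control law $u$ satisfies $$\Vert u(t)\Vert\leq \overline{C}_3e^{-\kappa_0t}\Vert X_0\Vert_{\mathcal{H}}+\overline{C}_4\sup_{\tau\in[0,t]}\Vert d(\tau)\Vert_{\mathcal{H}},$$ for all $t\geq 0$.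
   Context: Notation. $\mathbb{K}$ is $\mathbb{R}$ or $\mathbb{C}$; $(\mathcal{H},\langle\cdot,\cdot\rangle_{\mathcal{H}})$ is a separable Hilbert space over $\mathbb{K}$, with inner product linear in the first argument. $\mathbb{R}_+=[0,\infty)$, $\mathbb{R}_+^*=(0,\infty)$, $\mathbb{N}^*=\{1,2,\dots\}$. $\mathbb{K}^p$ carries the Euclidean norm, matrices the induced norm. Boundary control system. $\mathcal{A}:D(\mathcal{A})\subset\mathcal{H}\to\mathcal{H}$ and $\mathcal{B}:D(\mathcal{B})\subset\mathcal{H}\to\mathbb{K}^m$ are linear with $D(\mathcal{A})\subset D(\mathcal{B})$. $(\mathcal{A},\mathcal{B})$ is an abstract boundary control system if (1) $\mathcal{A}_0:=\mathcal{A}|_{D(\mathcal{A}_0)}$, $D(\mathcal{A}_0):=D(\mathcal{A})\cap\ker\mathcal{B}$, generates a $C_0$-semigroup $S$ on $\mathcal{H}$; (2) there is a bounded operator $B\in\mathcal{L}(\mathbb{K}^m,\mathcal{H})$ (a lifting operator) with $\mathrm{R}(B)\subset D(\mathcal{A})$, $\mathcal{A}B\in\mathcal{L}(\mathbb{K}^m,\mathcal{H})$ and $\mathcal{B}B=I_{\mathbb{K}^m}$. One such $B$ is fixed. Assumption (A1). $\mathcal{A}_0$ is a Riesz spectral operator: linear, closed, with simple eigenvalues $\lambda_n\in\mathbb{K}$ and corresponding eigenvectors $\phi_n\in D(\mathcal{A}_0)$, $n\in\mathbb{N}^*$, such that (i) $\{\phi_n\}$ is a Riesz basis: its span is dense in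 $\mathcal{H}$ and there are constants $m_R,M_R>0$ with $m_R\sum_{n=1}^N|\alpha_n|^2\leq\Vert\sum_{n=1}^N\alpha_n\phi_n\Vert_{\mathcal{H}}^2\leq M_R\sum_{n=1}^N|\alpha_n|^2$ for all $N\in\mathbb{N}^*$ and $\alpha_1,\dots,\alpha_N\in\mathbb{K}$; (ii) the closure of $\{\lambda_n\}$ is totally disconnected, i.e. for distinct $a,b$ in this closure, the segment $[a,b]$ is not contained in it. $\{\psi_n\}$ denotes the biorthogonal sequence: $\langle\phi_k,\psi_l\rangle_{\mathcal{H}}=\delta_{k,l}$. Assumption (A2). $N_0\in\mathbb{N}^*$ and $\alpha>0$ are such that $\operatorname{Re}\lambda_n\leq-\alpha$ for all $n\geq N_0+1$. Let $(e_1,\dots,e_m)$ be the canonical basis of $\mathbb{K}^m$, $b_{n,k}:=-\lambda_n\langle Be_k,\psi_n\rangle_{\mathcal{H}}+\langle\mathcal{A}Be_k,\psi_n\rangle_{\mathcal{H}}$, $A_{N_0}:=\mathrm{diag}(\lambda_1,\dots,\lambda_{N_0})$, $B_{N_0}:=(b_{n,k})_{1\leq n\leq N_0,1\leq k\leq m}\in\mathbb{K}^{N_0\times m}$. Assumption (A3). $(A_{N_0},B_{N_0})$ satisfies the Kalman (controllability) rank condition. Closed loop. Fixed data: the delay $D>0$; $t_0>0$; $\varphi\in\mathcal{C}^2([-D,+\infty);\mathbb{R})$ with $0\leq\varphi\leq1$, $\varphi=0$ on $[-D,0]$, $\varphi=1$ on $[t_0,+\infty)$; a gain $K\in\mathbb{K}^{m\times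 N_0}$ such that $A_{\mathrm{cl}}:=A_{N_0}+e^{-DA_{N_0}}B_{N_0}K$ is Hurwitz. The closed-loop system (CL) with initial condition $X_0$ and disturbance $d:\mathbb{R}_+\to\mathcal{H}$ is, for $t\geq0$: $\frac{\mathrm{d}X}{\mathrm{d}t}(t)=\mathcal{A}X(t)+d(t)$; $\mathcal{B}X(t)=u_D(t):=u(t-D)$; $u|_{[-D,0]}=0$; $u(t)=\varphi(t)KY(t)+\varphi(t)K\int_{\max(t-D,0)}^te^{(t-s-D)A_{N_0}}B_{N_0}u(s)\,\mathrm{d}s$; $Y(t)=(\langle X(t),\psi_1\rangle_{\mathcal{H}},\dots,\langle X(t),\psi_{N_0}\rangle_{\mathcal{H}})^\top$; $X(0)=X_0$. A classical solution is $X\in\mathcal{C}^0(\mathbb{R}_+;D(\mathcal{A}))\cap\mathcal{C}^1(\mathbb{R}_+;\mathcal{H})$ satisfying these equations; for $X_0\in D(\mathcal{A}_0)$ and $d\in\mathcal{C}^1(\mathbb{R}_+;\mathcal{H})$ it exists and is unique, with uniquely determined control $u$. *)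

theory Defs
  imports "HOL-Analysis.Analysis"
begin

section \<open>The scalar field: the real or the complex numbers\<close>

text \<open>
  A type of this class is, through the isometric embedding \<open>to_complex\<close>, a closed real subalgebra
  of the complex numbers, hence a copy of the reals or of the complex numbers (see
  \<open>range_to_complex\<close>); both \<^typ>\<open>real\<close> and \<^typ>\<open>complex\<close> are instances.
\<close>

class real_or_complex = real_normed_field + banach +
  fixes to_complex :: "'a \<Rightarrow> complex"
  assumes to_complex_add: "to_complex (x + y) = to_complex x + to_complex y"
    and to_complex_mult: "to_complex (x * y) = to_complex x * to_complex y"
    and to_complex_scaleR: "to_complex (r *\<^sub>R x) = r *\<^sub>R to_complex x"
    and norm_to_complex: "norm (to_complex x) = norm x"

instantiation real :: real_or_complex
begin
definition "to_complex (x::real) = complex_of_real x"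
instance by standard (auto simp: to_complex_real_def scaleR_conv_of_real)
end

instantiation complex :: real_or_complex
begin
definition "to_complex (x::complex) = x"
instance by standard (auto simp: to_complex_complex_def)
end

lemma range_to_complex:
  "range (to_complex :: 'k::real_or_complex \<Rightarrow> complex) = \<real> \<or>
   range (to_complex :: 'k \<Rightarrow> complex) = UNIV"
proof -
  let ?f = "to_complex :: 'k \<Rightarrow> complex"
  have "norm (?f 1) = 1" by (simp add: norm_to_complex)
  moreover have "?f 1 * ?f 1 = ?f 1" using to_complex_mult[of "1::'k" 1] by simp
  ultimately have one: "?f 1 = 1" by (metis mult_cancel_left1 norm_zero zero_neq_one)
  have r: "?f (r *\<^sub>R 1) = of_real r" for r
    by (simp only: to_complex_scaleR one) (simp add: scaleR_conv_of_real)
  show ?thesis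
  proof (cases "range ?f \<subseteq> \<real>")
    case True
    then show ?thesis using r by (metis Reals_def image_subsetI rangeI subset_antisym)
  next
    case False
    then obtain x where x: "Im (?f x) \<noteq> 0" unfolding complex_is_Real_iff subset_iff by blast
    have "z = ?f ((Im z / Im (?f x)) *\<^sub>R x + (Re z - Im z / Im (?f x) * Re (?f x)) *\<^sub>R 1)" for z
      using x unfolding to_complex_add r
      by (intro complex_eqI) (simp_all add: to_complex_scaleR)
    then show ?thesis by blast
  qed
qed

section \<open>Hilbert spaces and operators over the scalar field\<close>

text \<open>
  The norm of the type \<open>'h\<close> is required to be the one induced by the inner product \<open>ip\<close>;
  completeness and separability are carried by the type classes.
\<close>

definition separable_hilbert_space ::
  "('k::real_or_complex \<Rightarrow> 'h::{banach,second_countable_topology} \<Rightarrow> 'h) \<Rightarrow> ('h \<Rightarrow> 'h \<Rightarrow> 'k) \<Rightarrow> bool"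
  where "separable_hilbert_space scl ip \<longleftrightarrow>
    vector_space scl \<and>
    (\<forall>r x. scl (of_real r) x = r *\<^sub>R x) \<and>
    (\<forall>x y z. ip (x + y) z = ip x z + ip y z) \<and>
    (\<forall>c x y. ip (scl c x) y = c * ip x y) \<and>
    (\<forall>x y. to_complex (ip y x) = cnj (to_complex (ip x y))) \<and>
    (\<forall>x. ip x x = of_real ((norm x)\<^sup>2))"

text \<open>
  An unbounded operator is a total HOL function together with its domain; its values outside the
  domain are irrelevant.
\<close>

definition linear_operator ::
  "('k::field \<Rightarrow> 'a::ab_group_add \<Rightarrow> 'a) \<Rightarrow> ('k \<Rightarrow> 'b::ab_group_add \<Rightarrow> 'b) \<Rightarrow> 'a set \<Rightarrow> ('a \<Rightarrow> 'b) \<Rightarrow> bool"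
  where "linear_operator s1 s2 Dm T \<longleftrightarrow>
    module.subspace s1 Dm \<and>
    (\<forall>x\<in>Dm. \<forall>y\<in>Dm. T (x + y) = T x + T y) \<and>
    (\<forall>c. \<forall>x\<in>Dm. T (s1 c x) = s2 c (T x))"

definition closed_operator :: "'a::topological_space set \<Rightarrow> ('a \<Rightarrow> 'b::topological_space) \<Rightarrow> bool"
  where "closed_operator Dm T \<longleftrightarrow> closed ((\<lambda>x. (x, T x)) ` Dm)"

definition bounded_operator ::
  "('k::field \<Rightarrow> 'a::real_normed_vector \<Rightarrow> 'a) \<Rightarrow> ('k \<Rightarrow> 'b::real_normed_vector \<Rightarrow> 'b) \<Rightarrow> ('a \<Rightarrow> 'b) \<Rightarrow> bool"
  where "bounded_operator s1 s2 T \<longleftrightarrow> Vector_Spaces.linear s1 s2 T \<and> bounded_linear T"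

definition C0_semigroup ::
  "('k::field \<Rightarrow> 'h::real_normed_vector \<Rightarrow> 'h) \<Rightarrow> (real \<Rightarrow> 'h \<Rightarrow> 'h) \<Rightarrow> bool"
  where "C0_semigroup scl S \<longleftrightarrow>
    (\<forall>t\<ge>0. bounded_operator scl scl (S t)) \<and>
    S 0 = id \<and>
    (\<forall>s\<ge>0. \<forall>t\<ge>0. S (s + t) = S s \<circ> S t) \<and>
    (\<forall>x. ((\<lambda>t. S t x) \<longlongrightarrow> x) (at_right 0))"

definition infinitesimal_generator ::
  "(real \<Rightarrow> 'h::real_normed_vector \<Rightarrow> 'h) \<Rightarrow> 'h set \<Rightarrow> ('h \<Rightarrow> 'h) \<Rightarrow> bool"
  where "infinitesimal_generator S Dm T \<longleftrightarrow>
    (\<forall>x y. (x \<in> Dm \<and> T x = y) \<longleftrightarrow> ((\<lambda>t. (S t x - x) /\<^sub>R t) \<longlongrightarrow> y) (at_right 0))"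

section \<open>Abstract boundary control systems\<close>

definition dom0 :: "'h set \<Rightarrow> 'h set \<Rightarrow> ('h \<Rightarrow> 'c::zero) \<Rightarrow> 'h set"
  where "dom0 DA DB Bd = DA \<inter> {x \<in> DB. Bd x = 0}"

definition lifting_operator ::
  "('k::real_or_complex \<Rightarrow> 'h::real_normed_vector \<Rightarrow> 'h) \<Rightarrow> 'h set \<Rightarrow> ('h \<Rightarrow> 'h) \<Rightarrow> ('h \<Rightarrow> 'k^'m)
     \<Rightarrow> ('k^'m \<Rightarrow> 'h) \<Rightarrow> bool"
  where "lifting_operator scl DA A Bd L \<longleftrightarrow>
    bounded_operator (*s) scl L \<and>
    range L \<subseteq> DA \<and>
    bounded_operator (*s) scl (A \<circ> L) \<and>
    Bd \<circ> L = id"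

definition boundary_control_system ::
  "('k::real_or_complex \<Rightarrow> 'h::real_normed_vector \<Rightarrow> 'h)
     \<Rightarrow> 'h set \<Rightarrow> ('h \<Rightarrow> 'h) \<Rightarrow> 'h set \<Rightarrow> ('h \<Rightarrow> 'k^'m) \<Rightarrow> bool"
  where "boundary_control_system scl DA A DB Bd \<longleftrightarrow>
    linear_operator scl scl DA A \<and>
    linear_operator scl (*s) DB Bd \<and>
    DA \<subseteq> DB \<and>
    (\<exists>S. C0_semigroup scl S \<and> infinitesimal_generator S (dom0 DA DB Bd) A) \<and>
    (\<exists>L. lifting_operator scl DA A Bd L)"

section \<open>Riesz spectral operators\<close>

text \<open>Sequences indexed by the positive integers are functions on \<^typ>\<open>nat\<close> used only at \<open>n \<ge> 1\<close>.\<close>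

definition riesz_basis ::
  "('k::real_or_complex \<Rightarrow> 'h::real_normed_vector \<Rightarrow> 'h) \<Rightarrow> (nat \<Rightarrow> 'h) \<Rightarrow> bool"
  where "riesz_basis scl \<phi> \<longleftrightarrow>
    closure (module.span scl (\<phi> ` {1..})) = UNIV \<and>
    (\<exists>m M. m > 0 \<and> M > 0 \<and>
      (\<forall>N\<ge>1. \<forall>a :: nat \<Rightarrow> 'k.
         m * (\<Sum>n=1..N. (norm (a n))\<^sup>2) \<le> (norm (\<Sum>n=1..N. scl (a n) (\<phi> n)))\<^sup>2 \<and>
         (norm (\<Sum>n=1..N. scl (a n) (\<phi> n)))\<^sup>2 \<le> M * (\<Sum>n=1..N. (norm (a n))\<^sup>2)))"

text \<open>\<open>gen_kernel scl Dm T l j\<close> is the kernel of \<open>(T - l)\<^sup>j\<close>, with its natural domain.\<close>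

primrec gen_kernel ::
  "('k \<Rightarrow> 'h::ab_group_add \<Rightarrow> 'h) \<Rightarrow> 'h set \<Rightarrow> ('h \<Rightarrow> 'h) \<Rightarrow> 'k \<Rightarrow> nat \<Rightarrow> 'h set"
  where
    "gen_kernel scl Dm T l 0 = {0}"
  | "gen_kernel scl Dm T l (Suc j) = {x \<in> Dm. T x - scl l x \<in> gen_kernel scl Dm T l j}"

text \<open>Simple means of algebraic multiplicity one.\<close>

definition simple_eigenvalue ::
  "('k::field \<Rightarrow> 'h::ab_group_add \<Rightarrow> 'h) \<Rightarrow> 'h set \<Rightarrow> ('h \<Rightarrow> 'h) \<Rightarrow> 'k \<Rightarrow> bool"
  where "simple_eigenvalue scl Dm T l \<longleftrightarrow>
    vector_space.dim scl (\<Union>j. gen_kernel scl Dm T l j) = 1"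

definition riesz_spectral_operator ::
  "('k::real_or_complex \<Rightarrow> 'h::real_normed_vector \<Rightarrow> 'h) \<Rightarrow> 'h set \<Rightarrow> ('h \<Rightarrow> 'h)
     \<Rightarrow> (nat \<Rightarrow> 'k) \<Rightarrow> (nat \<Rightarrow> 'h) \<Rightarrow> bool"
  where "riesz_spectral_operator scl Dm T lam \<phi> \<longleftrightarrow>
    linear_operator scl scl Dm T \<and>
    closed_operator Dm T \<and>
    (\<forall>n\<ge>1. simple_eigenvalue scl Dm T (lam n) \<and>
           \<phi> n \<in> Dm \<and> \<phi> n \<noteq> 0 \<and> T (\<phi> n) = scl (lam n) (\<phi> n)) \<and>
    riesz_basis scl \<phi> \<and>
    (\<forall>a \<in> closure (lam ` {1..}). \<forall>b \<in> closure (lam ` {1..}).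
       a \<noteq> b \<longrightarrow> \<not> closed_segment a b \<subseteq> closure (lam ` {1..}))"

definition biorthogonal :: "('h \<Rightarrow> 'h \<Rightarrow> 'k::zero_neq_one) \<Rightarrow> (nat \<Rightarrow> 'h) \<Rightarrow> (nat \<Rightarrow> 'h) \<Rightarrow> bool"
  where "biorthogonal ip \<phi> \<psi> \<longleftrightarrow> (\<forall>k\<ge>1. \<forall>l\<ge>1. ip (\<phi> k) (\<psi> l) = (if k = l then 1 else 0))"

section \<open>Matrices\<close>

definition matpow :: "'k::real_or_complex^'n^'n \<Rightarrow> nat \<Rightarrow> 'k^'n^'n"
  where "matpow M j = (((**) M) ^^ j) (mat 1)"

definition matexp :: "'k::real_or_complex^'n^'n \<Rightarrow> 'k^'n^'n"
  where "matexp M = (\<Sum>j. matpow M j /\<^sub>R fact j)"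

text \<open>The eigenvalues meant here are the complex ones, also when the scalar field is real.\<close>

definition hurwitz :: "'k::real_or_complex^'n^'n \<Rightarrow> bool"
  where "hurwitz M \<longleftrightarrow>
    (\<forall>z v. v \<noteq> 0 \<and> (\<chi> i j. to_complex (M $ i $ j)) *v v = z *s v \<longrightarrow> Re z < 0)"

text \<open>
  In all that follows \<open>idx\<close> is a bijection from the finite type \<open>'n\<close> onto \<open>{1..N0}\<close>: the coordinate
  \<open>i :: 'n\<close> of a vector is its coordinate of number \<open>idx i\<close>.

  The matrix \<open>[B, A B, \<dots>, A\<^bsup>N0-1\<^esup> B]\<close>: its columns are indexed by pairs (block, column in the block).
\<close>

definition kalman_matrix ::
  "('n::finite \<Rightarrow> nat) \<Rightarrow> 'k::real_or_complex^'n^'n \<Rightarrow> 'k^'m^'n \<Rightarrow> 'k^('n \<times> 'm)^'n"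
  where "kalman_matrix idx M N = (\<chi> i p. (matpow M (idx (fst p) - 1) ** N) $ i $ snd p)"

definition kalman_condition ::
  "('n::finite \<Rightarrow> nat) \<Rightarrow> 'k::real_or_complex^'n^'n \<Rightarrow> 'k^'m^'n \<Rightarrow> bool"
  where "kalman_condition idx M N \<longleftrightarrow> rank (kalman_matrix idx M N) = CARD('n)"

definition A_trunc :: "('n::finite \<Rightarrow> nat) \<Rightarrow> (nat \<Rightarrow> 'k::real_or_complex) \<Rightarrow> 'k^'n^'n"
  where "A_trunc idx lam = (\<chi> i j. if i = j then lam (idx i) else 0)"

definition B_trunc ::
  "('n::finite \<Rightarrow> nat) \<Rightarrow> ('h \<Rightarrow> 'h \<Rightarrow> 'k::real_or_complex) \<Rightarrow> ('h \<Rightarrow> 'h) \<Rightarrow> ('k^'m \<Rightarrow> 'h)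
     \<Rightarrow> (nat \<Rightarrow> 'k) \<Rightarrow> (nat \<Rightarrow> 'h) \<Rightarrow> 'k^'m^'n"
  where "B_trunc idx ip A L lam \<psi> =
    (\<chi> i k. - lam (idx i) * ip (L (axis k 1)) (\<psi> (idx i)) + ip (A (L (axis k 1))) (\<psi> (idx i)))"

section \<open>The closed-loop system\<close>

text \<open>Derivatives at an endpoint of the interval \<open>I\<close> are one-sided.\<close>

definition C1_on :: "real set \<Rightarrow> (real \<Rightarrow> 'a::real_normed_vector) \<Rightarrow> bool"
  where "C1_on I f \<longleftrightarrow>
    (\<exists>f'. (\<forall>t\<in>I. (f has_vector_derivative f' t) (at t within I)) \<and> continuous_on I f')"

definition C2_on :: "real set \<Rightarrow> (real \<Rightarrow> 'a::real_normed_vector) \<Rightarrow> bool"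
  where "C2_on I f \<longleftrightarrow>
    (\<exists>f'. (\<forall>t\<in>I. (f has_vector_derivative f' t) (at t within I)) \<and> C1_on I f')"

definition transition_signal :: "real \<Rightarrow> real \<Rightarrow> (real \<Rightarrow> real) \<Rightarrow> bool"
  where "transition_signal D t0 \<theta> \<longleftrightarrow>
    C2_on {-D..} \<theta> \<and>
    (\<forall>t\<ge>-D. 0 \<le> \<theta> t \<and> \<theta> t \<le> 1) \<and>
    (\<forall>t\<in>{-D..0}. \<theta> t = 0) \<and>
    (\<forall>t\<ge>t0. \<theta> t = 1)"

definition modal_vector ::
  "('n::finite \<Rightarrow> nat) \<Rightarrow> ('h \<Rightarrow> 'h \<Rightarrow> 'k::real_or_complex) \<Rightarrow> (nat \<Rightarrow> 'h) \<Rightarrow> 'h \<Rightarrow> 'k^'n"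
  where "modal_vector idx ip \<psi> x = (\<chi> i. ip x (\<psi> (idx i)))"

text \<open>
  \<open>X\<close> is only considered on \<open>{0..}\<close> and \<open>u\<close> only on \<open>{-D..}\<close>. Membership of \<open>X\<close> in the continuous
  functions with values in the domain of \<open>A\<close> refers to the graph norm, i.e. continuity of both \<open>X\<close>
  and \<open>A X\<close>. Integrability is required explicitly because \<^const>\<open>integral\<close> is \<open>0\<close> otherwise.
\<close>

definition closed_loop_solution ::
  "('n::finite \<Rightarrow> nat) \<Rightarrow> ('h::real_normed_vector \<Rightarrow> 'h \<Rightarrow> 'k::real_or_complex)
     \<Rightarrow> 'h set \<Rightarrow> ('h \<Rightarrow> 'h) \<Rightarrow> ('h \<Rightarrow> 'k^'m) \<Rightarrow> (nat \<Rightarrow> 'h) \<Rightarrow> 'k^'n^'n \<Rightarrow> 'k^'m^'n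
     \<Rightarrow> real \<Rightarrow> (real \<Rightarrow> real) \<Rightarrow> 'k^'n^'m \<Rightarrow> 'h \<Rightarrow> (real \<Rightarrow> 'h)
     \<Rightarrow> (real \<Rightarrow> 'h) \<Rightarrow> (real \<Rightarrow> 'k^'m) \<Rightarrow> bool"
  where "closed_loop_solution idx ip DA A Bd \<psi> AN BN D \<theta> K X0 d X u \<longleftrightarrow>
    (\<forall>t\<ge>0. X t \<in> DA) \<and>
    continuous_on {0..} X \<and> continuous_on {0..} (\<lambda>t. A (X t)) \<and>
    C1_on {0..} X \<and>
    (\<forall>t\<ge>0. (X has_vector_derivative (A (X t) + d t)) (at t within {0..})) \<and>
    (\<forall>t\<ge>0. Bd (X t) = u (t - D)) \<and>
    (\<forall>t\<in>{-D..0}. u t = 0) \<and>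
    (\<forall>t\<ge>0.
       (\<lambda>s. (matexp ((t - s - D) *\<^sub>R AN) ** BN) *v u s) integrable_on {max (t - D) 0..t} \<and>
       u t = \<theta> t *\<^sub>R (K *v modal_vector idx ip \<psi> (X t)) +
             \<theta> t *\<^sub>R (K *v integral {max (t - D) 0..t}
                              (\<lambda>s. (matexp ((t - s - D) *\<^sub>R AN) ** BN) *v u s))) \<and>
    X 0 = X0"

end

(*
  The predictor variable Z(t) = Y(t) + int_{t-D}^t e^{(t-s-D)A_N} B_N u(s) ds turns the modal part of
  the loop into the delay-free system Z' = A_N Z + \<theta> e^{-D A_N} B_N K Z + (modes of d) with u = \<theta> K Z.
  Once \<theta> = 1 its matrix is Hurwitz, and before that time Gronwall's inequality suffices, so Z, u and u'
  are bounded by a e^{-\<kappa>t} + b with a ~ |X0| and b ~ sup |d|.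

  Put w(t) = X(t) - L u(t-D), which lies in the domain of the generator. Its n-th coordinate solves
  w_n' = \<lambda>_n w_n + f_n with f = A L u(t-D) + d - L u'(t-D), because the semigroup acts on the n-th
  coordinate as a scalar. The modes n > N0 are uniformly damped, and the sum of |w_n|^2 is
  estimated with a scalar differential inequality; the Riesz basis inequalities turn this into a
  bound of |w|, hence of |X|.

  Decay for a Hurwitz matrix M is obtained without matrix exponentials: an annihilating polynomial of
  minimal degree has only eigenvalues as roots, and splitting off one linear factor at a time reduces
  y' = M y + g to scalar equations y' = z y + r with Re z < 0.
*)
theory Submission
  imports Defs "HOL-Computational_Algebra.Fundamental_Theorem_Algebra"
begin

subsection \<open>Differential inequalities\<close>

text \<open>In the coordinates of \<open>X\<close> the input carries the factor
  \<open>lam n\<close>, for which no bound uniform in \<open>n\<close> is at hand. Passing to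
  \<open>w\<close> trades this factor for \<open>u'\<close>, so \<open>u'\<close> has to be
  estimated although the theorem does not mention it. The notion of solution says nothing about the
  regularity of \<open>u\<close> at positive times beyond the existence of window integrals;
  continuity and differentiability of \<open>u\<close> are therefore bootstrapped from the
  predictor. Every estimate lives on \<open>{0..T}\<close> with an arbitrary bound \<open>b\<close>
  of \<open>d\<close> there, and its constants are fixed before \<open>X0\<close>, \<open>d\<close>
  and \<open>T\<close>. The supremum over \<open>[0,t]\<close> enters only at the end, through
  \<open>T = t\<close>. One rate \<open>\<kappa>\<close> serves the Hurwitz matrix and the damped
  modes alike. Both provide damping \<open>2 * \<kappa>\<close>, that is \<open>4 * \<kappa>\<close>
  for squared norms; Young's inequality takes \<open>\<kappa>\<close> of it, and the remaining
  \<open>3 * \<kappa>\<close> still beats the rate \<open>2 * \<kappa>\<close> of a squared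
  envelope.\<close>

lemma comparison_square:
  fixes v h v' h' :: "real \<Rightarrow> real"
  assumes v: "\<And>t. t \<in> {0..T} \<Longrightarrow> (v has_real_derivative v' t) (at t within {0..T})"
    and h: "\<And>t. t \<in> {0..T} \<Longrightarrow> (h has_real_derivative h' t) (at t within {0..T})"
    and le: "\<And>t. t \<in> {0..T} \<Longrightarrow> v' t \<le> p * v t + q * (h t)\<^sup>2"
    and hge: "\<And>t. t \<in> {0..T} \<Longrightarrow> h' t \<ge> \<rho> * h t" "\<And>t. t \<in> {0..T} \<Longrightarrow> h t \<ge> 0"
    and init: "v 0 \<le> c * (h 0)\<^sup>2" and c: "c \<ge> 0" "q \<le> c * (2 * \<rho> - p)"
    and t: "t \<in> {0..T}"
  shows "v t \<le> c * (h t)\<^sup>2"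
proof -
  \<comment> \<open>\<open>c * h^2\<close> is a supersolution: its derivative is at least
    \<open>2 * c * \<rho> * h^2\<close>, hence at least \<open>p * (c * h^2) + q * h^2\<close> by
    the condition on \<open>c\<close>. \<open>W\<close> is the difference of the two functions times
    the integrating factor for \<open>p\<close>.\<close>
  define W where "W s = exp (- p * s) * (v s - c * (h s)\<^sup>2)" for s
  have W: "(W has_real_derivative exp (- p * s) * ((v' s - c * (2 * h s * h' s)) - p * (v s - c * (h s)\<^sup>2)))
      (at s within {0..T})" if "s \<in> {0..T}" for s
    unfolding W_def
    by (rule derivative_eq_intros v[OF that] h[OF that] refl)+ (simp add: algebra_simps)
  have neg: "exp (- p * s) * ((v' s - c * (2 * h s * h' s)) - p * (v s - c * (h s)\<^sup>2)) \<le> 0"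
    if s: "s \<in> {0..T}" for s
  proof -
    have "c * (2 * h s) * (\<rho> * h s) \<le> c * (2 * h s) * h' s"
      using hge[OF s] c by (intro mult_left_mono) auto
    moreover have "q * (h s)\<^sup>2 \<le> c * (2 * \<rho> - p) * (h s)\<^sup>2"
      using c by (intro mult_right_mono) auto
    ultimately have "(v' s - c * (2 * h s * h' s)) - p * (v s - c * (h s)\<^sup>2) \<le> 0"
      using le[OF s] by (simp add: algebra_simps power2_eq_square)
    then show ?thesis by (simp add: mult_nonneg_nonpos)
  qed
  have "W t \<le> W 0"
  proof (rule DERIV_nonpos_imp_decreasing_open[where f = W and a = 0 and b = t])
    show "0 \<le> t" using t by simp
    show "\<exists>y. (W has_real_derivative y) (at x) \<and> y \<le> 0" if "0 < x" "x < t" for x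
    proof -
      have "x \<in> {0..T}" "at x within {0..T} = at x"
        using that t by (auto intro!: at_within_interior simp: interior_atLeastAtMost_real)
      then show ?thesis using W[of x] neg[of x] by auto
    qed
    have "continuous_on {0..T} W"
      using W by (meson DERIV_continuous continuous_on_eq_continuous_within)
    then show "continuous_on {0..t} W" using t by (elim continuous_on_subset) auto
  qed
  also have "W 0 \<le> 0" using init by (simp add: W_def)
  finally show ?thesis by (simp add: W_def mult_le_0_iff)
qed

text \<open>Both summands of the final estimate in one function: \<open>a\<close> stands for the
  norm of \<open>X0\<close>, \<open>b\<close> for a bound on the disturbance. For nonnegative
  \<open>a\<close>, \<open>b\<close>, \<open>\<kappa>\<close> a delay costs only a factor, and the
  derivative is at least \<open>- \<kappa>\<close> times the function, so it can play
  \<open>h\<close> in \<open>comparison_square\<close>.\<close>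

definition envelope :: "real \<Rightarrow> real \<Rightarrow> real \<Rightarrow> real \<Rightarrow> real"
  where "envelope \<kappa> a b t = a * exp (- \<kappa> * t) + b"

lemma envelope_nonneg: "a \<ge> 0 \<Longrightarrow> b \<ge> 0 \<Longrightarrow> envelope \<kappa> a b t \<ge> 0"
  by (simp add: envelope_def)

lemma envelope_scale: "envelope \<kappa> (c * a) (c * b) t = c * envelope \<kappa> a b t"
  by (simp add: envelope_def algebra_simps)

lemma envelope_deriv: "(envelope \<kappa> a b has_real_derivative - \<kappa> * a * exp (- \<kappa> * t)) (at t within S)"
  unfolding envelope_def by (auto intro!: derivative_eq_intros)

text \<open>The decaying summand needs the factor; the constant one merely tolerates it. It bounds
  past values of the control by present ones and, started at time 0, turns an estimate on a bounded
  time interval into a decaying one.\<close>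

lemma envelope_shift:
  assumes "\<kappa> \<ge> 0" "a \<ge> 0" "b \<ge> 0" "s \<le> t" "t \<le> s + D"
  shows "envelope \<kappa> a b s \<le> exp (\<kappa> * D) * envelope \<kappa> a b t"
proof -
  have "\<kappa> * t \<le> \<kappa> * (s + D)" using assms by (intro mult_left_mono) auto
  then have "a * exp (- \<kappa> * s) \<le> a * exp (\<kappa> * D + - \<kappa> * t)"
    using assms by (intro mult_left_mono) (auto simp: algebra_simps)
  moreover have "0 \<le> \<kappa> * D" using assms by simp
  then have "1 * b \<le> exp (\<kappa> * D) * b"
    using assms by (intro mult_right_mono) auto
  ultimately show ?thesis unfolding envelope_def exp_add by (simp add: algebra_simps)
qed

lemma norm_square_has_derivative:
  fixes y :: "real \<Rightarrow> 'a::real_inner"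
  assumes "(y has_vector_derivative y') (at t within S)"
  shows "((\<lambda>t. (norm (y t))\<^sup>2) has_real_derivative 2 * (y t \<bullet> y')) (at t within S)"
proof -
  have "((\<lambda>t. y t \<bullet> y t) has_vector_derivative y t \<bullet> y' + y' \<bullet> y t) (at t within S)"
    by (rule bounded_bilinear.has_vector_derivative[OF bounded_bilinear_inner assms assms])
  then show ?thesis
    by (simp add: has_real_derivative_iff_has_vector_derivative power2_norm_eq_inner inner_commute)
qed

lemma two_mult_le_scaled_squares:
  fixes x y \<kappa> :: real
  assumes "\<kappa> > 0"
  shows "2 * x * y \<le> \<kappa> * x\<^sup>2 + y\<^sup>2 / \<kappa>"
proof -
  have "0 \<le> (\<kappa> * x - y)\<^sup>2 / \<kappa>" using assms by simp
  also have "\<dots> = \<kappa> * x\<^sup>2 + y\<^sup>2 / \<kappa> - 2 * x * y"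
    using assms by (simp add: field_simps power2_eq_square)
  finally show ?thesis by simp
qed

text \<open>The squared envelope decays at rate at most \<open>2 * \<kappa>\<close>, so a margin
  \<open>\<kappa>\<close> is left. The constant must be at least 1 for the initial value and at
  least \<open>1 / \<kappa>^2\<close> for the forcing; \<open>(1 + 1 / \<kappa>)^2\<close> is
  both.\<close>

lemma square_decay:
  fixes v v' :: "real \<Rightarrow> real"
  assumes \<kappa>: "\<kappa> > 0" and ab: "a \<ge> 0" "b \<ge> 0"
    and v: "\<And>t. t \<in> {0..T} \<Longrightarrow> (v has_real_derivative v' t) (at t within {0..T})"
    and le: "\<And>t. t \<in> {0..T} \<Longrightarrow> v' t \<le> - 3 * \<kappa> * v t + (envelope \<kappa> a b t)\<^sup>2 / \<kappa>"
    and init: "v 0 \<le> (a + b)\<^sup>2"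
    and t: "t \<in> {0..T}"
  shows "v t \<le> (1 + 1 / \<kappa>)\<^sup>2 * (envelope \<kappa> a b t)\<^sup>2"
proof (rule comparison_square[OF v envelope_deriv, where q = "1 / \<kappa>" and p = "- 3 * \<kappa>" and \<rho> = "- \<kappa>"])
  show "v' t \<le> - 3 * \<kappa> * v t + 1 / \<kappa> * (envelope \<kappa> a b t)\<^sup>2" if "t \<in> {0..T}" for t
    using le[OF that] by simp
  show "- \<kappa> * envelope \<kappa> a b t \<le> - \<kappa> * a * exp (- \<kappa> * t)" for t
    using ab \<kappa> by (simp add: envelope_def algebra_simps)
  show "0 \<le> envelope \<kappa> a b t" for t by (rule envelope_nonneg[OF ab])
  have one: "1 \<le> (1 + 1 / \<kappa>)\<^sup>2" using \<kappa> by simp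
  have "1 * (a + b)\<^sup>2 \<le> (1 + 1 / \<kappa>)\<^sup>2 * (a + b)\<^sup>2" by (rule mult_right_mono[OF one]) simp
  then show "v 0 \<le> (1 + 1 / \<kappa>)\<^sup>2 * (envelope \<kappa> a b 0)\<^sup>2" using init by (simp add: envelope_def)
  have "(1 / \<kappa>)\<^sup>2 * \<kappa> \<le> (1 + 1 / \<kappa>)\<^sup>2 * \<kappa>" using \<kappa> by (intro mult_right_mono power_mono) auto
  then show "1 / \<kappa> \<le> (1 + 1 / \<kappa>)\<^sup>2 * (2 * - \<kappa> - - 3 * \<kappa>)"
    using \<kappa> by (simp add: power2_eq_square)
qed (use t in auto)

lemma dissipative_decay:
  fixes y y' :: "real \<Rightarrow> 'a::real_inner"
  assumes \<kappa>: "\<kappa> > 0" and ab: "a \<ge> 0" "b \<ge> 0"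
    and y: "\<And>t. t \<in> {0..T} \<Longrightarrow> (y has_vector_derivative y' t) (at t within {0..T})"
    and le: "\<And>t. t \<in> {0..T} \<Longrightarrow> y t \<bullet> y' t \<le> - 2 * \<kappa> * (norm (y t))\<^sup>2 + norm (y t) * envelope \<kappa> a b t"
    and init: "norm (y 0) \<le> a + b"
    and t: "t \<in> {0..T}"
  shows "norm (y t) \<le> (1 + 1 / \<kappa>) * envelope \<kappa> a b t"
proof (rule power2_le_imp_le)
  have "(norm (y t))\<^sup>2 \<le> (1 + 1 / \<kappa>)\<^sup>2 * (envelope \<kappa> a b t)\<^sup>2"
  proof (rule square_decay[OF \<kappa> ab norm_square_has_derivative[OF y] _ _ t])
    show "2 * (y t \<bullet> y' t) \<le> - 3 * \<kappa> * (norm (y t))\<^sup>2 + (envelope \<kappa> a b t)\<^sup>2 / \<kappa>" if "t \<in> {0..T}" for t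
      using le[OF that] two_mult_le_scaled_squares[OF \<kappa>, of "norm (y t)" "envelope \<kappa> a b t"] by simp
    show "(norm (y 0))\<^sup>2 \<le> (a + b)\<^sup>2" using init by (intro power_mono) auto
  qed
  then show "(norm (y t))\<^sup>2 \<le> ((1 + 1 / \<kappa>) * envelope \<kappa> a b t)\<^sup>2" by (simp add: power_mult_distrib)
  show "0 \<le> (1 + 1 / \<kappa>) * envelope \<kappa> a b t" using \<kappa> envelope_nonneg[OF ab] by simp
qed

subsection \<open>Polynomials of a complex matrix\<close>

text \<open>The vector \<open>p(M) v\<close> by Horner's scheme. Only the action on vectors matters,
  so \<open>p(M)\<close> is never formed as a matrix.\<close>

definition poly_act :: "complex^'n^'n \<Rightarrow> complex poly \<Rightarrow> complex^'n \<Rightarrow> complex^'n"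
  where "poly_act M p v = fold_coeffs (\<lambda>a w. a *s v + M *v w) p 0"

lemma poly_act_0 [simp]: "poly_act M 0 v = 0"
  by (simp add: poly_act_def)

lemma poly_act_pCons [simp]: "poly_act M (pCons a p) v = a *s v + M *v poly_act M p v"
  by (cases "p = 0 \<and> a = 0") (auto simp: poly_act_def)

lemma poly_act_add: "poly_act M (p + q) v = poly_act M p v + poly_act M q v"
  by (induction p q rule: poly_induct2)
    (simp_all add: matrix_vector_right_distrib vector_sadd_rdistrib algebra_simps)

lemma poly_act_smult: "poly_act M (smult c p) v = c *s poly_act M p v"
  by (induction p)
    (simp_all add: vector_scalar_commute vector_add_ldistrib vector_smult_assoc)

lemma poly_act_mult: "poly_act M (p * q) v = poly_act M p (poly_act M q v)"
  by (induction p) (simp_all add: poly_act_add poly_act_smult)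

lemma poly_act_sum: "poly_act M (sum f I) v = (\<Sum>i\<in>I. poly_act M (f i) v)"
  by (induction I rule: infinite_finite_induct) (simp_all add: poly_act_add)

lemma poly_act_monom: "poly_act M (monom c i) v = c *s (((*v) M) ^^ i) v"
  by (induction i) (simp_all add: monom_0 monom_Suc vector_scalar_commute)

lemma poly_act_commute: "poly_act M p (M *v v) = M *v poly_act M p v"
proof -
  have "poly_act M (p * [:0, 1:]) v = poly_act M ([:0, 1:] * p) v" by (simp add: mult.commute)
  then show ?thesis unfolding poly_act_mult by simp
qed

lemma bounded_linear_poly_act: "bounded_linear (poly_act M p)"
proof -
  have add: "poly_act M p (v + w) = poly_act M p v + poly_act M p w" for v w
    by (induction p) (simp_all add: matrix_vector_right_distrib vector_add_ldistrib)
  have s: "r *\<^sub>R v = of_real r *s v" for r and v :: "complex^'n"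
    by (subst vec_eq_iff, unfold vector_scaleR_component vector_smult_component)
      (simp add: scaleR_conv_of_real)
  have "poly_act M p (c *s v) = c *s poly_act M p v" for c v
    by (induction p) (simp_all add: vector_scalar_commute vector_add_ldistrib vector_smult_assoc mult.commute)
  with add show ?thesis unfolding linear_conv_bounded_linear[symmetric] by (intro linearI) (simp_all add: s)
qed

text \<open>There is one more power of \<open>M\<close> than the real dimension of the matrix space,
  so the powers satisfy a linear relation; real coefficients suffice.\<close>

lemma exists_annihilating_poly:
  fixes M :: "complex^'n^'n"
  shows "\<exists>p. p \<noteq> 0 \<and> (\<forall>v. poly_act M p v = 0)"
proof -
  let ?d = "DIM(complex^'n^'n)"
  define P where "P i = (((**) M) ^^ i) (mat 1)" for i
  have P: "P i *v v = (((*v) M) ^^ i) v" for i v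
    unfolding P_def by (induction i) (simp_all add: matrix_vector_mul_assoc[symmetric])
  show ?thesis
  \<comment> \<open>Dependence is a property of the set of powers and does not see repetitions, so
    two equal powers are treated apart: they give \<open>X^i - X^j\<close> at once.\<close>
  proof (cases "inj_on P {..?d}")
    case False
    then obtain i j where ij: "i \<noteq> j" "P i = P j" by (auto simp: inj_on_def)
    then have "monom 1 i + monom (- 1) j \<noteq> (0::complex poly)"
      by (auto simp: poly_eq_iff dest!: spec[of _ i])
    moreover have "poly_act M (monom 1 i + monom (- 1) j) v = 0" for v
      using ij by (simp add: poly_act_add poly_act_monom P[symmetric])
    ultimately show ?thesis by blast
  next
    case True
    then have "card (P ` {..?d}) = Suc ?d" by (simp add: card_image)
    then have "dependent (P ` {..?d})"
      using independent_bound[of "P ` {..?d}"] by fastforce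
    then obtain u w where u: "w \<in> P ` {..?d}" "u w \<noteq> 0" "(\<Sum>x\<in>P ` {..?d}. u x *\<^sub>R x) = 0"
      by (auto simp: dependent_finite)
    then obtain k where k: "k \<le> ?d" "u (P k) \<noteq> 0" by auto
    define p where "p = (\<Sum>i\<le>?d. monom (complex_of_real (u (P i))) i)"
    have "coeff p k = of_real (u (P k))"
      using k by (simp add: p_def coeff_sum)
    then have "p \<noteq> 0" using k by auto
    moreover have "poly_act M p v = 0" for v
    proof -
      have s: "(r *\<^sub>R N) *v v = of_real r *s (N *v v)" for r and N :: "complex^'n^'n"
        by (simp add: vec_eq_iff matrix_vector_mult_def sum_distrib_left)
          (simp add: scaleR_conv_of_real mult.assoc)
      have "poly_act M p v = (\<Sum>i\<le>?d. of_real (u (P i)) *s (P i *v v))"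
        by (simp add: p_def poly_act_sum poly_act_monom P)
      also have "\<dots> = (\<Sum>i\<le>?d. u (P i) *\<^sub>R P i) *v v"
        by (induction rule: infinite_finite_induct[of _ "{..?d}"])
          (simp_all add: matrix_vector_mult_add_rdistrib s)
      also have "(\<Sum>i\<le>?d. u (P i) *\<^sub>R P i) = 0"
        using u(3) True by (simp add: sum.reindex)
      finally show ?thesis by simp
    qed
    ultimately show ?thesis by blast
  qed
qed

text \<open>Write \<open>p = (X - z) q\<close>. By minimality \<open>q(M) v\<close> is nonzero for
  some \<open>v\<close>, and \<open>M - z\<close> kills it: this vector is the eigenvector.\<close>

lemma exists_spectral_poly:
  fixes M :: "complex^'n^'n"
  shows "\<exists>p. p \<noteq> 0 \<and> (\<forall>v. poly_act M p v = 0) \<and>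
    (\<forall>z. poly p z = 0 \<longrightarrow> (\<exists>v. v \<noteq> 0 \<and> M *v v = z *s v))"
proof -
  obtain p where p: "p \<noteq> 0" "\<And>v. poly_act M p v = 0"
    and min: "\<And>q. q \<noteq> 0 \<Longrightarrow> (\<And>v. poly_act M q v = 0) \<Longrightarrow> degree p \<le> degree q"
    using ex_has_least_nat[of "\<lambda>p. p \<noteq> 0 \<and> (\<forall>v. poly_act M p v = 0)" _ degree]
      exists_annihilating_poly[of M] by metis
  have "\<exists>v. v \<noteq> 0 \<and> M *v v = z *s v" if z: "poly p z = 0" for z
  proof -
    obtain q where q: "p = [:- z, 1:] * q" using z by (auto simp: poly_eq_0_iff_dvd elim: dvdE)
    then have "q \<noteq> 0" using p by auto
    then have "degree q < degree p" using q by (simp add: degree_mult_eq del: mult_pCons_left)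
    then obtain v where v: "poly_act M q v \<noteq> 0" using min[OF \<open>q \<noteq> 0\<close>] by fastforce
    have "poly_act M [:- z, 1:] (poly_act M q v) = 0"
      using p(2)[of v] unfolding q poly_act_mult .
    then have "M *v poly_act M q v = z *s poly_act M q v"
      by (simp add: vector_sneg_minus1[symmetric])
    with v show ?thesis by blast
  qed
  with p show ?thesis by blast
qed

lemma bounded_linear_norm_bound:
  assumes "bounded_linear f"
  obtains C where "C \<ge> 0" "\<And>x. norm (f x) \<le> C * norm x"
  using bounded_linear.nonneg_bounded[OF assms] by (metis mult.commute)

text \<open>The induction statement for splitting off roots: a solution is under control once its
  forcing, its initial value and \<open>p(M) y\<close> are. For annihilating \<open>p\<close> the
  last condition is void; for constant \<open>p\<close> it is the conclusion up to a factor.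
  \<open>C\<close> precedes horizon and data.\<close>

definition poly_controls :: "complex^'n^'n \<Rightarrow> real \<Rightarrow> complex poly \<Rightarrow> real \<Rightarrow> bool"
  where "poly_controls M \<kappa> p C \<longleftrightarrow> (\<forall>T a b y g. a \<ge> 0 \<longrightarrow> b \<ge> 0 \<longrightarrow>
      (\<forall>t\<in>{0..T}. (y has_vector_derivative M *v y t + g t) (at t within {0..T})) \<longrightarrow>
      (\<forall>t\<in>{0..T}. norm (g t) \<le> envelope \<kappa> a b t) \<longrightarrow>
      (\<forall>t\<in>{0..T}. norm (poly_act M p (y t)) \<le> envelope \<kappa> a b t) \<longrightarrow>
      norm (y 0) \<le> a + b \<longrightarrow>
      (\<forall>t\<in>{0..T}. norm (y t) \<le> C * envelope \<kappa> a b t))"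

lemmas poly_controlsD = poly_controls_def[THEN iffD1, rule_format]

text \<open>With \<open>p = (X - z) q\<close>, the vector \<open>x = q(M) y\<close> solves
  \<open>x' = z x + p(M) y + q(M) g\<close>, which has scalar damping and controlled forcing. The
  resulting bound on \<open>x\<close> is exactly what the induction hypothesis for \<open>q\<close>
  asks for.\<close>

lemma stable_poly_act_bound:
  fixes M :: "complex^'n^'n"
  assumes \<kappa>: "\<kappa> > 0"
  shows "p \<noteq> 0 \<Longrightarrow> (\<And>z. poly p z = 0 \<Longrightarrow> Re z \<le> - 2 * \<kappa>) \<Longrightarrow>
    \<exists>C\<ge>0. poly_controls M \<kappa> p C"
proof (induction "degree p" arbitrary: p)
  case 0
  then obtain c where p: "p = [:c:]" by (auto elim: degree_eq_zeroE)
  with 0 have c: "c \<noteq> 0" by auto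
  have n: "norm (c *s v) = norm c * norm v" for v :: "complex^'n"
    by (simp add: norm_vec_def L2_set_def norm_mult power_mult_distrib sum_distrib_left[symmetric] real_sqrt_mult)
  show ?case
  proof (unfold poly_controls_def, intro exI[of _ "1 / norm c"] conjI allI impI ballI)
    fix T a b t and y :: "real \<Rightarrow> complex^'n"
    assume "\<forall>t\<in>{0..T}. norm (poly_act M p (y t)) \<le> envelope \<kappa> a b t" "t \<in> {0..T}"
    then show "norm (y t) \<le> 1 / norm c * envelope \<kappa> a b t"
      using c by (auto simp: p n field_simps)
  qed simp
next
  case (Suc k)
  then have "\<not> constant (poly p)" by (simp add: constant_degree)
  then obtain z where z: "poly p z = 0" using fundamental_theorem_of_algebra by blast
  then obtain q where q: "p = [:- z, 1:] * q" by (auto simp: poly_eq_0_iff_dvd elim: dvdE)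
  have q0: "q \<noteq> 0" using Suc.prems q by auto
  have "degree p = Suc (degree q)" unfolding q using q0 by (subst degree_mult_eq) auto
  with Suc have deg: "k = degree q" by simp
  have roots: "Re w \<le> - 2 * \<kappa>" if "poly q w = 0" for w
    using Suc.prems(2)[of w] that by (simp add: q)
  from Suc.hyps(1)[OF deg q0 roots] obtain C where C: "C \<ge> 0"
    and IH: "poly_controls M \<kappa> q C"
    by blast
  obtain Q where Q: "Q \<ge> 0" "\<And>v. norm (poly_act M q v) \<le> Q * norm v"
    using bounded_linear_norm_bound[OF bounded_linear_poly_act] by blast
  \<comment> \<open>A common dilation of the envelope: the 1 keeps the bounds on \<open>g\<close>
    and \<open>y 0\<close> valid, the rest bounds \<open>q(M) y\<close>, whose forcing is
    \<open>p(M) y\<close> with weight 1 plus \<open>q(M) g\<close> with weight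
    \<open>Q\<close>.\<close>
  define c where "c = 1 + (1 + 1 / \<kappa>) * (1 + Q)"
  have c: "c \<ge> 1" "c \<ge> 0" using Q \<kappa> by (auto simp: c_def)
  show ?case
  proof (unfold poly_controls_def, intro exI[of _ "C * c"] conjI allI impI ballI)
    show "C * c \<ge> 0" using C c by simp
    fix T a b t :: real and y g :: "real \<Rightarrow> complex^'n"
    assume ab: "a \<ge> 0" "b \<ge> 0"
      and y: "\<forall>t\<in>{0..T}. (y has_vector_derivative M *v y t + g t) (at t within {0..T})"
      and g: "\<forall>t\<in>{0..T}. norm (g t) \<le> envelope \<kappa> a b t"
      and py: "\<forall>t\<in>{0..T}. norm (poly_act M p (y t)) \<le> envelope \<kappa> a b t"
      and y0: "norm (y 0) \<le> a + b" and t: "t \<in> {0..T}"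
    let ?E = "envelope \<kappa> a b"
    let ?x = "\<lambda>t. poly_act M q (y t)"
    note E0 = envelope_nonneg[OF ab, of \<kappa>]
    have x: "(?x has_vector_derivative poly_act M q (M *v y s + g s)) (at s within {0..T})"
      if "s \<in> {0..T}" for s
      using bounded_linear.has_vector_derivative[OF bounded_linear_poly_act] y that by blast
    have x': "poly_act M q (M *v y s + g s) = z *s ?x s + (poly_act M p (y s) + poly_act M q (g s))" for s
    proof -
      have "poly_act M p (y s) = M *v ?x s - z *s ?x s"
        unfolding q poly_act_mult by (simp add: vector_smult_lneg)
      then show ?thesis
        by (simp add: linear_add[OF bounded_linear.linear[OF bounded_linear_poly_act]] poly_act_commute)
    qed
    have xb: "norm (?x s) \<le> (1 + 1 / \<kappa>) * envelope \<kappa> ((1 + Q) * a) ((1 + Q) * b) s" if s: "s \<in> {0..T}" for s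
    proof (rule dissipative_decay[OF \<kappa> _ _ x _ _ s])
      fix r assume r: "r \<in> {0..T}"
      have "norm (poly_act M p (y r) + poly_act M q (g r)) \<le> ?E r + Q * ?E r"
        using py g r Q mult_left_mono[OF bspec[OF g r] Q(1)]
        by (intro norm_triangle_le add_mono) (auto intro: order_trans)
      then have rb: "norm (poly_act M p (y r) + poly_act M q (g r)) \<le> envelope \<kappa> ((1 + Q) * a) ((1 + Q) * b) r"
        unfolding envelope_scale by (simp add: algebra_simps)
      have "?x r \<bullet> (z *s ?x r) = Re z * (norm (?x r))\<^sup>2"
        by (simp add: inner_vec_def power2_norm_eq_inner sum_distrib_left inner_complex_def algebra_simps)
      also have "\<dots> \<le> (- 2 * \<kappa>) * (norm (?x r))\<^sup>2"
        using Suc.prems(2)[OF z] by (intro mult_right_mono) auto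
      finally show "?x r \<bullet> poly_act M q (M *v y r + g r)
        \<le> - 2 * \<kappa> * (norm (?x r))\<^sup>2 + norm (?x r) * envelope \<kappa> ((1 + Q) * a) ((1 + Q) * b) r"
        unfolding x' inner_add_right[of _ "z *s ?x r"]
        using norm_cauchy_schwarz[of "?x r" "poly_act M p (y r) + poly_act M q (g r)"]
          mult_left_mono[OF rb norm_ge_zero[of "?x r"]]
        by linarith
    next
      have "norm (?x 0) \<le> Q * (a + b)" using Q(2)[of "y 0"] mult_left_mono[OF y0 Q(1)] by linarith
      also have "\<dots> \<le> (1 + Q) * a + (1 + Q) * b" using ab by (simp add: algebra_simps)
      finally show "norm (?x 0) \<le> (1 + Q) * a + (1 + Q) * b" .
    qed (use ab Q in auto)
    have mono: "?E s \<le> c * ?E s" for s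
      using mult_right_mono[OF c(1) E0[of s]] by simp
    have "norm (y t) \<le> C * envelope \<kappa> (c * a) (c * b) t"
    proof (rule poly_controlsD[OF IH])
      fix s assume s: "s \<in> {0..T}"
      show "(y has_vector_derivative M *v y s + g s) (at s within {0..T})" using y s by blast
      show "norm (g s) \<le> envelope \<kappa> (c * a) (c * b) s"
        unfolding envelope_scale using g s mono by (meson order_trans)
      show "norm (?x s) \<le> envelope \<kappa> (c * a) (c * b) s"
      proof -
        have "norm (?x s) \<le> (c - 1) * ?E s"
          using xb[OF s] by (simp add: envelope_scale c_def mult.assoc)
        then show ?thesis
          unfolding envelope_scale using E0[of s] by (simp add: algebra_simps)
      qed
    next
      have "1 * (a + b) \<le> c * (a + b)" using c ab by (intro mult_right_mono) auto
      then show "norm (y 0) \<le> c * a + c * b" using y0 by (simp add: algebra_simps)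
    qed (use ab c t in auto)
    then show "norm (y t) \<le> C * c * ?E t" by (simp add: envelope_scale mult.assoc)
  qed
qed

theorem hurwitz_matrix_decay:
  fixes M :: "complex^'n^'n"
  assumes M: "\<And>z v. v \<noteq> 0 \<Longrightarrow> M *v v = z *s v \<Longrightarrow> Re z < 0"
    and \<delta>: "\<delta> > 0"
  obtains \<kappa> C where "\<kappa> > 0" "\<kappa> \<le> \<delta>" "C \<ge> 0"
    "\<And>T a b y g t. \<lbrakk>a \<ge> 0; b \<ge> 0;
      \<And>t. t \<in> {0..T} \<Longrightarrow> (y has_vector_derivative M *v y t + g t) (at t within {0..T});
      \<And>t. t \<in> {0..T} \<Longrightarrow> norm (g t) \<le> envelope \<kappa> a b t;
      norm (y 0) \<le> a + b; t \<in> {0..T}\<rbrakk> \<Longrightarrow> norm (y t) \<le> C * envelope \<kappa> a b t"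
proof -
  obtain p where p: "p \<noteq> 0" "\<And>v. poly_act M p v = 0"
    and eig: "\<And>z. poly p z = 0 \<Longrightarrow> \<exists>v. v \<noteq> 0 \<and> M *v v = z *s v"
    using exists_spectral_poly[of M] by blast
  define R where "R = {z. poly p z = 0}"
  have R: "finite R" unfolding R_def using p(1) by (rule poly_roots_finite)
  have neg: "Re z < 0" if "z \<in> R" for z using eig M that by (auto simp: R_def)
  \<comment> \<open>Half the distance of the finitely many roots from the imaginary axis, since the
    damping condition asks for \<open>2 * \<kappa>\<close>. Inserting \<open>\<delta>\<close> caps
    the rate and keeps the set nonempty.\<close>
  define \<kappa> where "\<kappa> = Min (insert \<delta> ((\<lambda>z. - Re z / 2) ` R))"
  have \<kappa>: "\<kappa> > 0" "\<kappa> \<le> \<delta>" using R neg \<delta> by (auto simp: \<kappa>_def)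
  have "Re z \<le> - 2 * \<kappa>" if "poly p z = 0" for z
  proof -
    have "\<kappa> \<le> - Re z / 2" unfolding \<kappa>_def using R that by (intro Min_le) (auto simp: R_def)
    then show ?thesis by simp
  qed
  from stable_poly_act_bound[OF \<kappa>(1) p(1) this] obtain C where C: "C \<ge> 0"
    and b: "poly_controls M \<kappa> p C"
    by blast
  show thesis
    by (rule that[OF \<kappa> C], rule poly_controlsD[OF b]) (auto simp: p envelope_nonneg)
qed

subsection \<open>The embedding into the complex numbers\<close>

lemma bounded_linear_to_complex: "bounded_linear to_complex"
  by (rule bounded_linear_intro[where K = 1])
    (simp_all add: to_complex_add to_complex_scaleR norm_to_complex)

lemmas to_complex_0 [simp] = linear_0[OF bounded_linear.linear[OF bounded_linear_to_complex]]
lemmas to_complex_sum = linear_sum[OF bounded_linear.linear[OF bounded_linear_to_complex]]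

lemma to_complex_1 [simp]: "to_complex (1::'k::real_or_complex) = 1"
proof -
  have "to_complex (1::'k) * to_complex (1::'k) = to_complex (1::'k)"
    by (simp flip: to_complex_mult)
  moreover have "norm (to_complex (1::'k)) = 1" by (simp add: norm_to_complex)
  ultimately show ?thesis by (metis mult_cancel_left1 norm_zero zero_neq_one)
qed

lemma to_complex_of_real [simp]: "to_complex (of_real r :: 'k::real_or_complex) = of_real r"
  by (simp add: of_real_def to_complex_scaleR)

subsection \<open>Hilbert spaces over the scalar field\<close>

locale hilbert_over =
  fixes scl :: "'k::real_or_complex \<Rightarrow> 'h::{banach,second_countable_topology} \<Rightarrow> 'h"
    and ip :: "'h \<Rightarrow> 'h \<Rightarrow> 'k"
  assumes hilbert: "separable_hilbert_space scl ip"
begin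

sublocale vs: vector_space scl
  using hilbert unfolding separable_hilbert_space_def by (elim conjE)

lemma scl_of_real: "scl (of_real r) x = r *\<^sub>R x"
  and ip_add_left: "ip (x + y) z = ip x z + ip y z"
  and ip_scl_left: "ip (scl c x) y = c * ip x y"
  and ip_commute: "to_complex (ip y x) = cnj (to_complex (ip x y))"
  and ip_self: "ip x x = of_real ((norm x)\<^sup>2)"
  using hilbert unfolding separable_hilbert_space_def by blast+

lemma ip_scaleR_left: "ip (r *\<^sub>R x) y = r *\<^sub>R ip x y"
  by (simp flip: scl_of_real add: ip_scl_left scaleR_conv_of_real)

lemma ip_linear: "linear (\<lambda>x. ip x y)"
  by (intro linearI ip_add_left ip_scaleR_left)

lemma ip_sum_left: "ip (sum f I) y = (\<Sum>i\<in>I. ip (f i) y)"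
  by (rule linear_sum[OF ip_linear])

lemma norm_scl: "norm (scl c x) = norm c * norm x"
proof -
  have "to_complex (ip (scl c x) (scl c x)) = to_complex c * cnj (to_complex c * to_complex (ip x x))"
    by (metis ip_commute ip_scl_left to_complex_mult)
  then have "norm (to_complex (ip (scl c x) (scl c x)))
      = norm (to_complex c * cnj (to_complex c * to_complex (ip x x)))"
    by simp
  then have "(norm (scl c x))\<^sup>2 = norm c * (norm c * (norm x)\<^sup>2)"
    by (simp only: norm_to_complex norm_mult ip_self norm_of_real complex_mod_cnj abs_power2)
  then have "(norm (scl c x))\<^sup>2 = (norm c * norm x)\<^sup>2"
    by (simp add: power2_eq_square)
  then show ?thesis by (simp add: power2_eq_iff_nonneg)
qed

text \<open>The norm belongs to the type, so its triangle inequality is available; squared and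
  expanded it is the real part of Cauchy-Schwarz.\<close>

lemma Re_ip_le: "Re (to_complex (ip x y)) \<le> norm x * norm y"
proof -
  have "to_complex (ip (x + y) (x + y)) = to_complex (ip x (x + y)) + to_complex (ip y (x + y))"
    by (simp add: ip_add_left to_complex_add)
  also have "\<dots> = cnj (to_complex (ip x x)) + cnj (to_complex (ip y x))
      + (cnj (to_complex (ip x y)) + cnj (to_complex (ip y y)))"
    unfolding ip_commute[of x "x + y"] ip_commute[of y "x + y"]
    by (simp add: ip_add_left to_complex_add)
  finally have "(norm (x + y))\<^sup>2 = (norm x)\<^sup>2 + 2 * Re (to_complex (ip x y)) + (norm y)\<^sup>2"
    unfolding ip_self ip_commute[of x y] by (simp add: complex_eq_iff del: of_real_power)
  moreover have "(norm (x + y))\<^sup>2 \<le> (norm x + norm y)\<^sup>2"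
    by (intro power_mono norm_triangle_ineq norm_ge_zero)
  ultimately show ?thesis by (simp add: power2_eq_square algebra_simps)
qed

text \<open>Dividing \<open>x\<close> by the inner product makes that product 1, which is its own
  real part.\<close>

lemma norm_ip_le: "norm (ip x y) \<le> norm x * norm y"
proof (cases "ip x y = 0")
  case False
  have "ip (scl (inverse (ip x y)) x) y = 1" using False by (simp add: ip_scl_left)
  then have "1 \<le> inverse (norm (ip x y)) * norm x * norm y"
    using Re_ip_le[of "scl (inverse (ip x y)) x" y] by (simp only: norm_scl norm_inverse to_complex_1 one_complex.sel)
  then have "norm (ip x y) * 1 \<le> norm (ip x y) * (inverse (norm (ip x y)) * norm x * norm y)"
    by (rule mult_left_mono) simp
  then show ?thesis using False by (simp add: mult.assoc[symmetric])
qed simp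

lemma bounded_linear_ip: "bounded_linear (\<lambda>x. ip x y)"
  by (rule bounded_linear_intro[where K = "norm y"])
    (simp_all add: ip_add_left ip_scaleR_left norm_ip_le)

lemmas continuous_on_ip [continuous_intros] = bounded_linear.continuous_on[OF bounded_linear_ip]

lemma bounded_linear_scl_left: "bounded_linear (\<lambda>c. scl c x)"
proof (rule bounded_linear_intro[where K = "norm x"])
  show "scl (r *\<^sub>R c) x = r *\<^sub>R scl c x" for r c
    by (simp flip: scl_of_real add: scaleR_conv_of_real)
qed (simp_all add: vs.scale_left_distrib norm_scl)

end

subsection \<open>Riesz bases\<close>

locale riesz_hilbert = hilbert_over scl ip
  for scl :: "'k::real_or_complex \<Rightarrow> 'h::{banach,second_countable_topology} \<Rightarrow> 'h"
    and ip :: "'h \<Rightarrow> 'h \<Rightarrow> 'k" +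
  fixes \<phi> \<psi> :: "nat \<Rightarrow> 'h"
  assumes riesz: "riesz_basis scl \<phi>"
    and biorth: "biorthogonal ip \<phi> \<psi>"
begin

lemma ip_basis: "k \<ge> 1 \<Longrightarrow> l \<ge> 1 \<Longrightarrow> ip (\<phi> k) (\<psi> l) = (if k = l then 1 else 0)"
  using biorth by (simp add: biorthogonal_def)

definition partial_expansion :: "nat \<Rightarrow> 'h \<Rightarrow> 'h"
  where "partial_expansion N x = (\<Sum>n=1..N. scl (ip x (\<psi> n)) (\<phi> n))"

lemma linear_partial_expansion: "linear (partial_expansion N)"
  unfolding partial_expansion_def
  by (rule bounded_linear.linear, rule bounded_linear_sum,
      rule bounded_linear_compose[OF bounded_linear_scl_left bounded_linear_ip])

lemma span_partial_expansion:
  assumes "x \<in> vs.span (\<phi> ` {1..})"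
  shows "\<exists>N\<^sub>0. \<forall>N\<ge>N\<^sub>0. partial_expansion N x = x"
  using assms
proof (induction rule: vs.span_induct_alt)
  case base
  show ?case by (simp add: partial_expansion_def linear_0[OF ip_linear])
next
  case (step c b y)
  then obtain k N\<^sub>0 where k: "k \<ge> 1" "b = \<phi> k" and N: "\<And>N. N \<ge> N\<^sub>0 \<Longrightarrow> partial_expansion N y = y"
    by auto
  have "partial_expansion N (scl c b + y) = scl c b + y" if "N \<ge> max k N\<^sub>0" for N
  proof -
    have "partial_expansion N (scl c b) = (\<Sum>n=1..N. if n = k then scl c b else 0)"
      unfolding partial_expansion_def using k by (intro sum.cong) (auto simp: ip_scl_left ip_basis)
    also have "\<dots> = scl c b" using k that by simp
    finally show ?thesis using N[of N] that by (simp add: linear_add[OF linear_partial_expansion])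
  qed
  then show ?case by blast
qed

lemma dense_span: "closure (vs.span (\<phi> ` {1..})) = UNIV"
  using riesz by (simp add: riesz_basis_def)

lemma dense_induct:
  assumes "closed {x. P x}" "\<And>x. x \<in> vs.span (\<phi> ` {1..}) \<Longrightarrow> P x"
  shows "P x"
proof -
  have "closure (vs.span (\<phi> ` {1..})) \<subseteq> {x. P x}"
    using assms(2) by (intro closure_minimal[OF _ assms(1)] subsetI CollectI)
  then show ?thesis unfolding dense_span by blast
qed

text \<open>The Riesz inequalities concern finite combinations only. For each \<open>N\<close> the
  first bound is a closed condition on \<open>x\<close> and passes from the span to its closure. The
  second assumes a uniform bound on partial sums, since this is what the modal estimates deliver; no
  series has to be summed.\<close>

lemma riesz_bounds:
  obtains C where "C > 0"
    "\<And>x N. (\<Sum>n=1..N. (norm (ip x (\<psi> n)))\<^sup>2) \<le> C * (norm x)\<^sup>2"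
    "\<And>x B. (\<And>N. (\<Sum>n=1..N. (norm (ip x (\<psi> n)))\<^sup>2) \<le> B) \<Longrightarrow> (norm x)\<^sup>2 \<le> C * B"
proof -
  obtain m M where mM: "m > 0" "M > 0"
    and bounds: "\<forall>N\<ge>1. \<forall>a :: nat \<Rightarrow> 'k.
      m * (\<Sum>n=1..N. (norm (a n))\<^sup>2) \<le> (norm (\<Sum>n=1..N. scl (a n) (\<phi> n)))\<^sup>2 \<and>
      (norm (\<Sum>n=1..N. scl (a n) (\<phi> n)))\<^sup>2 \<le> M * (\<Sum>n=1..N. (norm (a n))\<^sup>2)"
    using riesz unfolding riesz_basis_def by (elim conjE exE)
  note R = bounds[rule_format, THEN conjunct1] bounds[rule_format, THEN conjunct2]
  let ?s = "\<lambda>N x. \<Sum>n=1..N. (norm (ip x (\<psi> n)))\<^sup>2"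
  have bessel: "m * ?s N x \<le> (norm x)\<^sup>2" for N x
  proof (rule dense_induct[where P = "\<lambda>x. m * ?s N x \<le> (norm x)\<^sup>2"])
    show "closed {x. m * ?s N x \<le> (norm x)\<^sup>2}"
      by (intro closed_Collect_le continuous_intros)
    fix x assume "x \<in> vs.span (\<phi> ` {1..})"
    then obtain N\<^sub>0 where "\<And>N. N \<ge> N\<^sub>0 \<Longrightarrow> partial_expansion N x = x"
      using span_partial_expansion by blast
    \<comment> \<open>The index is moved past \<open>N\<close> and past the point where the
      expansion is exact; partial sums only grow. The 1 respects the range \<open>N \<ge> 1\<close>
      of the Riesz inequalities.\<close>
    then have "m * ?s (max 1 (max N N\<^sub>0)) x \<le> (norm x)\<^sup>2"
      using R(1)[of "max 1 (max N N\<^sub>0)" "\<lambda>n. ip x (\<psi> n)"] by (simp add: partial_expansion_def)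
    moreover have "?s N x \<le> ?s (max 1 (max N N\<^sub>0)) x" by (intro sum_mono2) auto
    ultimately show "m * ?s N x \<le> (norm x)\<^sup>2"
      using mM by (meson mult_left_mono less_imp_le order_trans)
  qed
  have proj: "(norm (partial_expansion N x))\<^sup>2 \<le> M * ?s N x" for N x
    using R(2)[of N "\<lambda>n. ip x (\<psi> n)"] by (cases "N \<ge> 1") (auto simp: partial_expansion_def)
  have synth: "(norm x)\<^sup>2 \<le> M * B" if B: "\<And>N. ?s N x \<le> B" for x B
  proof -
    have "B \<ge> 0" using B[of 0] by simp
    have "norm x \<le> sqrt (M * B) + \<epsilon>" if "\<epsilon> > 0" for \<epsilon>
    proof -
      \<comment> \<open>Let \<open>P\<close> be the partial expansion at an index where it fixes
        \<open>y\<close>. Then \<open>x = (x - y) + P (y - x) + P x\<close>, and the norm of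
        \<open>P\<close> is at most \<open>sqrt (M / m)\<close> at every index, so
        \<open>\<delta>\<close> makes the first two terms at most \<open>\<epsilon>\<close>
        together.\<close>
      define \<delta> where "\<delta> = \<epsilon> / (1 + sqrt (M / m))"
      have s0: "1 + sqrt (M / m) > 0" using mM by (simp add: add_pos_nonneg)
      then have \<delta>: "\<delta> > 0" and \<delta>_eq: "\<delta> * (1 + sqrt (M / m)) = \<epsilon>" using that by (simp_all add: \<delta>_def)
      obtain y where y: "y \<in> vs.span (\<phi> ` {1..})" "dist y x < \<delta>"
        using \<delta> dense_span closure_approachable[of x "vs.span (\<phi> ` {1..})"] by auto
      then obtain N where N: "partial_expansion N y = y"
        using span_partial_expansion by blast
      have "(norm (partial_expansion N (y - x)))\<^sup>2 \<le> M * ((norm (y - x))\<^sup>2 / m)"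
        by (rule order_trans[OF proj]) (use bessel[of "y - x" N] mM in \<open>simp add: field_simps\<close>)
      then have "norm (partial_expansion N (y - x)) \<le> sqrt (M / m) * norm (y - x)"
      proof (rule power2_le_imp_le[OF order_trans])
        have "(sqrt (M / m))\<^sup>2 = M / m" using mM by (intro real_sqrt_pow2) simp
        then show "M * ((norm (y - x))\<^sup>2 / m) \<le> (sqrt (M / m) * norm (y - x))\<^sup>2"
          by (simp only: power_mult_distrib) simp
      qed (use mM in simp)
      moreover have "(norm (partial_expansion N x))\<^sup>2 \<le> M * B"
        using proj[of N x] B[of N] mM by (meson mult_left_mono less_imp_le order_trans)
      then have "norm (partial_expansion N x) \<le> sqrt (M * B)"
        by (simp add: real_le_rsqrt)
      moreover have "x = (x - y) + partial_expansion N (y - x) + partial_expansion N x"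
        using N by (simp add: linear_diff[OF linear_partial_expansion])
      then have "norm x \<le> norm (x - y) + norm (partial_expansion N (y - x)) + norm (partial_expansion N x)"
        by (metis norm_triangle_ineq norm_triangle_le add_right_mono)
      moreover have "norm (x - y) * (1 + sqrt (M / m)) \<le> \<delta> * (1 + sqrt (M / m))"
        using y(2) s0 by (intro mult_right_mono) (auto simp: dist_norm norm_minus_commute)
      then have "norm (x - y) + sqrt (M / m) * norm (y - x) \<le> \<epsilon>"
        using \<delta>_eq by (simp add: algebra_simps norm_minus_commute)
      ultimately show ?thesis by linarith
    qed
    then have "norm x \<le> sqrt (M * B)" by (rule field_le_epsilon)
    then have "(norm x)\<^sup>2 \<le> (sqrt (M * B))\<^sup>2" by (intro power_mono) auto
    then show ?thesis using mM \<open>B \<ge> 0\<close> by simp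
  qed
  show thesis
  proof (rule that[of "max M (1 / m)"])
    show "?s N x \<le> max M (1 / m) * (norm x)\<^sup>2" for N x
    proof -
      have "?s N x \<le> 1 / m * (norm x)\<^sup>2" using bessel[of x N] mM by (simp add: field_simps)
      also have "\<dots> \<le> max M (1 / m) * (norm x)\<^sup>2" by (intro mult_right_mono) auto
      finally show ?thesis .
    qed
    show "(norm x)\<^sup>2 \<le> max M (1 / m) * B" if "\<And>N. ?s N x \<le> B" for x B
    proof -
      have "B \<ge> 0" using that[of 0] by simp
      then have "M * B \<le> max M (1 / m) * B" by (intro mult_right_mono) auto
      then show ?thesis using synth[OF that] by linarith
    qed
  qed (use mM in auto)
qed

lemma simple_eigenspace:
  assumes "simple_eigenvalue scl Dm T l" "e \<in> Dm" "e \<noteq> 0" "T e = scl l e" "x \<in> Dm" "T x = scl l x"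
  shows "\<exists>c. x = scl c e"
proof -
  define U where "U = (\<Union>j. gen_kernel scl Dm T l j)"
  have "x \<in> gen_kernel scl Dm T l (Suc 0)" "e \<in> gen_kernel scl Dm T l (Suc 0)" using assms by auto
  then have xe: "x \<in> U" "e \<in> U" unfolding U_def by (blast intro: UN_I[OF UNIV_I])+
  have "vs.dim U = 1" using assms(1) by (simp add: simple_eigenvalue_def U_def)
  \<comment> \<open>The default value of \<open>dim\<close> is 0, so the value 1 ensures that the
    set chosen below is a basis.\<close>
  then have ex: "\<exists>B. \<not> vs.dependent B \<and> vs.span B = vs.span U"
    by (auto simp: vs.dim_def split: if_splits)
  define B where "B = (SOME B. \<not> vs.dependent B \<and> vs.span B = vs.span U)"
  have "vs.span B = vs.span U" unfolding B_def using someI_ex[OF ex] by simp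
  moreover have "card B = 1" using \<open>vs.dim U = 1\<close> ex by (simp add: vs.dim_def B_def)
  ultimately obtain f where "vs.span {f} = vs.span U" by (auto simp: card_1_singleton_iff)
  with xe have "x \<in> vs.span {f}" "e \<in> vs.span {f}" by (auto intro: vs.span_base)
  then obtain a b where ab: "x = scl a f" "e = scl b f" by (auto simp: vs.span_singleton)
  with assms(3) have "b \<noteq> 0" by auto
  then have "x = scl (a / b) e" using ab by simp
  then show ?thesis ..
qed

text \<open>The semigroup commutes with its generator, so it leaves each one-dimensional eigenspace
  invariant; by density it acts on the \<open>n\<close>-th coordinate as a scalar, which is differentiated at 0.\<close>

lemma generator_coordinate:
  assumes S: "C0_semigroup scl S" and gen: "infinitesimal_generator S Dm T"
    and eig: "\<And>n. n \<ge> 1 \<Longrightarrow> simple_eigenvalue scl Dm T (lam n) \<and> \<phi> n \<in> Dm \<and> \<phi> n \<noteq> 0 \<and> T (\<phi> n) = scl (lam n) (\<phi> n)"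
    and n: "n \<ge> 1" and w: "w \<in> Dm"
  shows "ip (T w) (\<psi> n) = lam n * ip w (\<psi> n)"
proof -
  have bl: "bounded_linear (S t)" and lin: "Vector_Spaces.linear scl scl (S t)" if "t \<ge> 0" for t
    using S that by (auto simp: C0_semigroup_def bounded_operator_def)
  have scl_S: "S t (scl c x) = scl c (S t x)" if "t \<ge> 0" for t c x
    using lin[OF that] by (simp add: Vector_Spaces.linear_iff)
  have SS: "S (s + t) x = S s (S t x)" if "s \<ge> 0" "t \<ge> 0" for s t x
    using S that by (simp add: C0_semigroup_def)
  have lims: "((\<lambda>t. (S t x - x) /\<^sub>R t) \<longlongrightarrow> T x) (at_right 0)" if "x \<in> Dm" for x
    using gen that by (auto simp: infinitesimal_generator_def)
  have "\<exists>c. S h (\<phi> k) = scl c (\<phi> k)" if k: "k \<ge> 1" and h: "h \<ge> 0" for k h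
  proof (rule simple_eigenspace)
    have "((\<lambda>t. S h ((S t (\<phi> k) - \<phi> k) /\<^sub>R t)) \<longlongrightarrow> S h (T (\<phi> k))) (at_right 0)"
      using eig k by (intro bounded_linear.tendsto[OF bl[OF h]] lims) auto
    moreover have "S h ((S t (\<phi> k) - \<phi> k) /\<^sub>R t) = (S t (S h (\<phi> k)) - S h (\<phi> k)) /\<^sub>R t" if "t > 0" for t
    proof -
      have "S h (S t (\<phi> k)) = S t (S h (\<phi> k))"
        using SS[of h t] SS[of t h] h that by (simp add: add.commute)
      then show ?thesis
        using bounded_linear.linear[OF bl[OF h]] by (simp add: linear_diff linear_scale)
    qed
    then have "\<forall>\<^sub>F t in at_right 0. S h ((S t (\<phi> k) - \<phi> k) /\<^sub>R t) = (S t (S h (\<phi> k)) - S h (\<phi> k)) /\<^sub>R t"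
      by (intro eventually_mono[OF eventually_at_right_less[of 0]])
    ultimately have "((\<lambda>t. (S t (S h (\<phi> k)) - S h (\<phi> k)) /\<^sub>R t) \<longlongrightarrow> S h (T (\<phi> k))) (at_right 0)"
      by (rule Lim_transform_eventually)
    then show "S h (\<phi> k) \<in> Dm" "T (S h (\<phi> k)) = scl (lam k) (S h (\<phi> k))"
      using gen eig[OF k] scl_S[OF h] by (auto simp: infinitesimal_generator_def)
  qed (use eig[OF k] in auto)
  then obtain c where c: "\<And>k h. k \<ge> 1 \<Longrightarrow> h \<ge> 0 \<Longrightarrow> S h (\<phi> k) = scl (c k h) (\<phi> k)" by metis
  have coord: "ip (S h x) (\<psi> n) = c n h * ip x (\<psi> n)" if h: "h \<ge> 0" for h x
  proof (rule dense_induct[where P = "\<lambda>x. ip (S h x) (\<psi> n) = c n h * ip x (\<psi> n)"])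
    show "closed {x. ip (S h x) (\<psi> n) = c n h * ip x (\<psi> n)}"
      by (intro closed_Collect_eq continuous_intros bounded_linear.continuous_on[OF bl[OF h]])
    show "ip (S h x) (\<psi> n) = c n h * ip x (\<psi> n)" if "x \<in> vs.span (\<phi> ` {1..})" for x
      using that
    proof (induction rule: vs.span_induct_alt)
      case base
      then show ?case by (simp add: linear_0[OF ip_linear] linear_0[OF bounded_linear.linear[OF bl[OF h]]])
    next
      case (step a b y)
      then obtain k where "k \<ge> 1" "b = \<phi> k" by auto
      then show ?case
        using step.IH n h
        by (simp add: linear_add[OF bounded_linear.linear[OF bl[OF h]]] scl_S[OF h]
            ip_add_left ip_scl_left c ip_basis algebra_simps)
    qed
  qed
  have q: "ip ((S h x - x) /\<^sub>R h) (\<psi> n) = ((c n h - 1) /\<^sub>R h) * ip x (\<psi> n)" if "h > 0" for h x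
    using that by (simp add: ip_scaleR_left linear_diff[OF ip_linear] coord algebra_simps)
  have lim: "((\<lambda>h. ((c n h - 1) /\<^sub>R h) * ip x (\<psi> n)) \<longlongrightarrow> ip (T x) (\<psi> n)) (at_right 0)" if "x \<in> Dm" for x
    by (rule Lim_transform_eventually[OF bounded_linear.tendsto[OF bounded_linear_ip lims[OF that]]])
      (intro eventually_mono[OF eventually_at_right_less[of 0]] q)
  \<comment> \<open>The vector \<open>\<phi> n\<close> has \<open>n\<close>-th coordinate 1, so its
    own difference quotient identifies the derivative of \<open>c n\<close> at 0, which then serves
    for every \<open>w\<close>.\<close>
  have "((\<lambda>h. (c n h - 1) /\<^sub>R h) \<longlongrightarrow> lam n) (at_right 0)"
    using lim[of "\<phi> n"] eig[OF n] n by (simp add: ip_basis ip_scl_left)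
  then have "((\<lambda>h. ((c n h - 1) /\<^sub>R h) * ip w (\<psi> n)) \<longlongrightarrow> lam n * ip w (\<psi> n)) (at_right 0)"
    by (intro tendsto_mult tendsto_const)
  with lim[OF w] show ?thesis by (metis tendsto_unique trivial_limit_at_right_real)
qed

end

subsection \<open>Vectors and matrices over the scalar field\<close>

lemma bounded_linear_matrix_vector:
  fixes M :: "'k::real_or_complex^'n^'m"
  shows "bounded_linear ((*v) M)"
proof (rule bounded_linear_intro[where K = "\<Sum>i\<in>UNIV. \<Sum>j\<in>UNIV. norm (M $ i $ j)"])
  show "M *v (r *\<^sub>R x) = r *\<^sub>R (M *v x)" for r x
    by (simp add: vec_eq_iff matrix_vector_mult_def scaleR_sum_right)
  show "norm (M *v x) \<le> norm x * (\<Sum>i\<in>UNIV. \<Sum>j\<in>UNIV. norm (M $ i $ j))" for x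
  proof -
    have "norm (M *v x) \<le> (\<Sum>i\<in>UNIV. norm ((M *v x) $ i))"
      unfolding norm_vec_def by (rule L2_set_le_sum) simp
    also have "\<dots> \<le> (\<Sum>i\<in>UNIV. \<Sum>j\<in>UNIV. norm (M $ i $ j) * norm x)"
      unfolding matrix_vector_mult_def
      by (auto intro!: sum_mono order_trans[OF norm_sum] mult_left_mono Finite_Cartesian_Product.norm_nth_le simp: norm_mult)
    finally show ?thesis by (simp add: sum_distrib_left mult.commute)
  qed
qed (simp add: matrix_vector_right_distrib)

text \<open>Complexification serves two ends: \<open>hurwitz\<close> speaks of complex eigenvalues
  even over the reals, and vectors over the abstract field carry no real inner product with which to
  differentiate a squared norm. As \<open>cvec\<close> is isometric, bounds come back
  unchanged.\<close>

definition cvec :: "'k::real_or_complex^'n \<Rightarrow> complex^'n"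
  where "cvec v = (\<chi> i. to_complex (v $ i))"

definition cmat :: "'k::real_or_complex^'n^'m \<Rightarrow> complex^'n^'m"
  where "cmat M = (\<chi> i j. to_complex (M $ i $ j))"

lemma norm_cvec [simp]: "norm (cvec v) = norm v"
  by (simp add: cvec_def norm_vec_def norm_to_complex)

lemma bounded_linear_cvec: "bounded_linear cvec"
  by (rule bounded_linear_intro[where K = 1])
    (simp_all add: vec_eq_iff, simp_all add: cvec_def to_complex_add to_complex_scaleR)

lemma cvec_mult: "cvec (M *v v) = cmat M *v cvec v"
  by (simp add: vec_eq_iff cvec_def cmat_def matrix_vector_mult_def to_complex_sum to_complex_mult)

lemma matpow_diagonal:
  "matpow (\<chi> i j. if i = j then c i else 0) k = (\<chi> i j. if i = j then c i ^ k else 0)"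
proof (induction k)
  case 0
  then show ?case by (simp add: matpow_def mat_def vec_eq_iff)
next
  case (Suc k)
  then have "matpow (\<chi> i j. if i = j then c i else 0) (Suc k)
      = (\<chi> i j. if i = j then c i else 0) ** (\<chi> i j. if i = j then c i ^ k else 0)"
    by (simp add: matpow_def)
  also have "\<dots> = (\<chi> i j. if i = j then c i ^ Suc k else 0)"
    by (simp add: vec_eq_iff matrix_matrix_mult_def if_distrib[of "\<lambda>x. x * _"] cong: if_cong)
  finally show ?case .
qed

lemma matexp_diagonal:
  fixes c :: "'n::finite \<Rightarrow> 'k::real_or_complex"
  shows "matexp (\<chi> i j. if i = j then c i else 0) = (\<chi> i j. if i = j then exp (c i) else 0)"
  unfolding matexp_def
proof (rule sums_unique[symmetric], unfold sums_def, intro vec_tendstoI)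
  fix i j
  have "(\<lambda>k. c i ^ k /\<^sub>R fact k) sums exp (c i)" by (rule exp_converges)
  then show "(\<lambda>n. (\<Sum>k<n. matpow (\<chi> i j. if i = j then c i else 0) k /\<^sub>R fact k) $ i $ j)
    \<longlonglongrightarrow> (\<chi> i j. if i = j then exp (c i) else 0) $ i $ j"
    by (cases "i = j") (simp_all add: matpow_diagonal sums_def)
qed

lemma diagonal_matrix_vector:
  "((\<chi> i j. if i = j then c i else 0) *v v) $ i = c i * v $ i"
  by (simp add: matrix_vector_mult_def if_distrib[of "\<lambda>x. x * _"] cong: if_cong)

text \<open>The matrix is diagonal, so each component sees a scalar exponential. The predictor can
  then be treated component by component, with the scalar functional equation only.\<close>

lemma matexp_A_trunc:
  fixes v :: "'k::real_or_complex^'m"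
  shows "((matexp (r *\<^sub>R A_trunc idx lam) ** N) *v v) $ i = exp (r *\<^sub>R lam (idx i)) * (N *v v) $ i"
proof -
  have "r *\<^sub>R A_trunc idx lam = (\<chi> i j. if i = j then r *\<^sub>R lam (idx i) else 0)"
    by (simp add: vec_eq_iff A_trunc_def)
  then have "matexp (r *\<^sub>R A_trunc idx lam) = (\<chi> i j. if i = j then exp (r *\<^sub>R lam (idx i)) else 0)"
    by (simp add: matexp_diagonal)
  then show ?thesis
    by (simp only: matrix_vector_mul_assoc[symmetric] diagonal_matrix_vector)
qed

subsection \<open>Derivatives and integrals along the real line\<close>

lemma has_vector_derivative_vecI:
  fixes f :: "real \<Rightarrow> 'a::real_normed_vector^'n"
  assumes "\<And>i. ((\<lambda>t. f t $ i) has_vector_derivative f' $ i) (at t within S)"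
  shows "(f has_vector_derivative f') (at t within S)"
  unfolding has_vector_derivative_def has_derivative_within
proof (intro conjI vec_tendstoI)
  show "bounded_linear (\<lambda>x. x *\<^sub>R f')" by (rule bounded_linear_scaleR_left)
  show "((\<lambda>y. ((1 / norm (y - t)) *\<^sub>R (f y - (f t + (y - t) *\<^sub>R f'))) $ i) \<longlongrightarrow> 0 $ i) (at t within S)" for i
    using assms[of i] by (simp add: has_vector_derivative_def has_derivative_within)
qed

lemma has_vector_derivative_within_Un:
  assumes "(f has_vector_derivative f') (at t within S)" "(f has_vector_derivative f') (at t within T)"
  shows "(f has_vector_derivative f') (at t within S \<union> T)"
  using assms unfolding has_vector_derivative_def has_derivative_within
  unfolding at_within_union by (auto intro: filterlim_sup)

lemma at_within_atLeast:
  fixes t :: real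
  assumes "a \<le> t" "t < b"
  shows "at t within {a..} = at t within {a..b}"
  by (rule at_within_nhd[of _ "{..<b}"]) (use assms in auto)

lemma continuous_on_atLeastI:
  fixes f :: "real \<Rightarrow> 'a::topological_space"
  assumes "\<And>b. b \<ge> c \<Longrightarrow> continuous_on {a..b} f"
  shows "continuous_on {a..} f"
proof (unfold continuous_on_eq_continuous_within, intro ballI)
  fix t assume t: "t \<in> {a..}"
  then have "continuous (at t within {a..max c (t + 1)}) f"
    using assms[of "max c (t + 1)"] by (auto simp: continuous_on_eq_continuous_within)
  then show "continuous (at t within {a..}) f"
    using at_within_atLeast[of a t "max c (t + 1)"] t by simp
qed

lemma integral_has_vector_derivative_atLeast:
  fixes f :: "real \<Rightarrow> 'a::banach"
  assumes "continuous_on {a..} f" "t \<ge> a"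
  shows "((\<lambda>t. integral {a..t} f) has_vector_derivative f t) (at t within {a..})"
proof -
  have "continuous_on {a..t + 1} f" using assms(1) by (rule continuous_on_subset) auto
  then show ?thesis
    using integral_has_vector_derivative[of a "t + 1" f t] assms(2) at_within_atLeast[of a t "t + 1"] by simp
qed

lemma has_vector_derivative_shift:
  fixes f :: "real \<Rightarrow> 'a::real_normed_vector"
  assumes "(f has_vector_derivative f') (at (t - D) within {- D..})"
  shows "((\<lambda>t. f (t - D)) has_vector_derivative f') (at t within {0..})"
proof -
  have "(\<lambda>t. t - D) ` {0..} = {- D..}"
    by (auto intro: image_eqI[of _ _ "_ + D"])
  moreover have "((\<lambda>t. t - D) has_vector_derivative 1) (at t within {0..})"
    by (auto intro!: derivative_eq_intros)
  ultimately show ?thesis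
    using vector_diff_chain_within[of "\<lambda>t. t - D" 1 t "{0..}" f f'] assms by (simp add: o_def)
qed

text \<open>No points of \<open>S\<close> are near \<open>t\<close>, so the claim is vacuous. It
  lets derivatives on two adjacent closed intervals be glued at every point of their union.\<close>

lemma has_vector_derivative_outside_closed:
  assumes "closed S" "t \<notin> S"
  shows "(f has_vector_derivative f') (at t within S)"
proof -
  have "at t within S = bot" using assms by (metis closed_limpt trivial_limit_within)
  then show ?thesis
    unfolding has_vector_derivative_def has_derivative_within
    by (simp add: bounded_linear_scaleR_left)
qed

subsection \<open>The closed loop\<close>

locale delay_feedback = riesz_hilbert scl ip \<phi> \<psi>
  for scl :: "'k::real_or_complex \<Rightarrow> 'h::{banach,second_countable_topology} \<Rightarrow> 'h"
    and ip :: "'h \<Rightarrow> 'h \<Rightarrow> 'k"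
    and \<phi> \<psi> :: "nat \<Rightarrow> 'h" +
  fixes DA DB :: "'h set"
    and A :: "'h \<Rightarrow> 'h"
    and Bd :: "'h \<Rightarrow> 'k^'m"
    and L :: "'k^'m \<Rightarrow> 'h"
    and lam :: "nat \<Rightarrow> 'k"
    and N0 :: nat
    and idx :: "'n::finite \<Rightarrow> nat"
    and \<alpha> D t0 :: real
    and \<theta> :: "real \<Rightarrow> real"
    and K :: "'k^'n^'m"
    and AN :: "'k^'n^'n"
    and BN :: "'k^'m^'n"
  assumes bcs: "boundary_control_system scl DA A DB Bd"
    and lifting: "lifting_operator scl DA A Bd L"
    and A1: "riesz_spectral_operator scl (dom0 DA DB Bd) A lam \<phi>"
    and idx: "bij_betw idx UNIV {1..N0}"
    and A2: "\<alpha> > 0" "\<forall>n\<ge>N0 + 1. Re (to_complex (lam n)) \<le> - \<alpha>"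
    and AN: "AN = A_trunc idx lam"
    and BN: "BN = B_trunc idx ip A L lam \<psi>"
    and D: "D > 0"
    and t0: "t0 > 0"
    and \<theta>: "transition_signal D t0 \<theta>"
    and K: "hurwitz (AN + matexp ((- D) *\<^sub>R AN) ** BN ** K)"
begin

section \<open>The boundary control system in modal coordinates\<close>

lemma generator_coordinate0:
  assumes "w \<in> dom0 DA DB Bd" "n \<ge> 1"
  shows "ip (A w) (\<psi> n) = lam n * ip w (\<psi> n)"
proof -
  obtain S where "C0_semigroup scl S" "infinitesimal_generator S (dom0 DA DB Bd) A"
    using bcs unfolding boundary_control_system_def by blast
  then show ?thesis
    by (rule generator_coordinate) (use A1 assms in \<open>auto simp: riesz_spectral_operator_def\<close>)
qed

lemma lift: "bounded_linear L" "bounded_linear (\<lambda>v. A (L v))" "L v \<in> DA" "Bd (L v) = v"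
  and lift_linear: "Vector_Spaces.linear (*s) scl L" "Vector_Spaces.linear (*s) scl (\<lambda>v. A (L v))"
  using lifting by (auto simp: lifting_operator_def bounded_operator_def o_def fun_eq_iff)

text \<open>Removing the lifted boundary value brings \<open>x\<close> into the domain of the
  generator, where coordinates are governed by the eigenvalues; the remainder involves only the
  bounded operator \<open>A L\<close>.\<close>

lemma lifted_in_dom0:
  assumes "x \<in> DA"
  shows "x - L (Bd x) \<in> dom0 DA DB Bd" "A x = A (x - L (Bd x)) + A (L (Bd x))"
proof -
  have sub: "vs.subspace DA" and A: "\<And>x y. x \<in> DA \<Longrightarrow> y \<in> DA \<Longrightarrow> A (x + y) = A x + A y"
    and subB: "vs.subspace DB" and DAB: "DA \<subseteq> DB"
    and Bd: "\<And>x y. x \<in> DB \<Longrightarrow> y \<in> DB \<Longrightarrow> Bd (x + y) = Bd x + Bd y"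
    using bcs by (auto simp: boundary_control_system_def linear_operator_def)
  have in_DA: "x - L (Bd x) \<in> DA" by (intro vs.subspace_diff sub assms lift)
  then have "Bd x = Bd (x - L (Bd x)) + Bd (L (Bd x))"
    using Bd[of "x - L (Bd x)" "L (Bd x)"] DAB lift(3) by auto
  then have "Bd (x - L (Bd x)) = 0" by (simp add: lift)
  then show "x - L (Bd x) \<in> dom0 DA DB Bd" using in_DA DAB by (auto simp: dom0_def)
  show "A x = A (x - L (Bd x)) + A (L (Bd x))"
    using A[OF in_DA lift(3), of "Bd x"] by simp
qed

lemma idx_ge_1: "idx i \<ge> 1"
  using idx by (auto simp: bij_betw_def)

text \<open>Linearity extends the entries, given on the canonical basis, to all inputs; the
  right-hand side is the input term of the coordinate equation.\<close>

lemma BN_mult: "(BN *v v) $ i = - lam (idx i) * ip (L v) (\<psi> (idx i)) + ip (A (L v)) (\<psi> (idx i))"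
proof -
  have e: "ip (f v) y = (\<Sum>k\<in>UNIV. v $ k * ip (f (axis k 1)) y)"
    if f: "Vector_Spaces.linear (*s) scl f" for f :: "'k^'m \<Rightarrow> 'h" and y
  proof -
    interpret f: Vector_Spaces.linear "(*s)" scl f by fact
    have "f v = f (\<Sum>k\<in>UNIV. v $ k *s axis k 1)" by (simp add: basis_expansion)
    also have "\<dots> = (\<Sum>k\<in>UNIV. scl (v $ k) (f (axis k 1)))" by (simp add: f.sum f.scale)
    finally show ?thesis by (simp add: ip_sum_left ip_scl_left)
  qed
  show ?thesis
    unfolding e[OF lift_linear(1)] e[OF lift_linear(2)]
    by (simp add: BN B_trunc_def matrix_vector_mult_def sum_distrib_left sum.distrib[symmetric] algebra_simps)
qed

definition run :: "'h \<Rightarrow> (real \<Rightarrow> 'h) \<Rightarrow> (real \<Rightarrow> 'h) \<Rightarrow> (real \<Rightarrow> 'k^'m) \<Rightarrow> bool"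
  where "run X0 d X u \<longleftrightarrow> closed_loop_solution idx ip DA A Bd \<psi> AN BN D \<theta> K X0 d X u"

abbreviation modal :: "'h \<Rightarrow> 'k^'n"
  where "modal \<equiv> modal_vector idx ip \<psi>"

definition EB :: "'k^'m^'n"
  where "EB = matexp ((- D) *\<^sub>R AN) ** BN"

lemma EB_nth: "(EB *v v) $ i = exp ((- D) *\<^sub>R lam (idx i)) * (BN *v v) $ i"
  unfolding EB_def by (simp only: AN matexp_A_trunc)

text \<open>The Artstein transformation, which turns the delayed input into an undelayed one.\<close>

definition artstein :: "(real \<Rightarrow> 'h) \<Rightarrow> (real \<Rightarrow> 'k^'m) \<Rightarrow> real \<Rightarrow> 'k^'n"
  where "artstein X u t = modal (X t) +
    integral {max (t - D) 0..t} (\<lambda>s. (matexp ((t - s - D) *\<^sub>R AN) ** BN) *v u s)"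

lemma bounded_linear_modal: "bounded_linear modal"
proof -
  have "\<exists>C. \<forall>x. norm (modal x) \<le> norm x * C"
  proof (intro exI allI)
    fix x
    have "norm (modal x) \<le> (\<Sum>i\<in>UNIV. norm (modal x $ i))"
      unfolding norm_vec_def by (rule L2_set_le_sum) simp
    also have "\<dots> \<le> (\<Sum>i\<in>UNIV. norm x * norm (\<psi> (idx i)))"
      by (intro sum_mono) (simp add: modal_vector_def norm_ip_le)
    finally show "norm (modal x) \<le> norm x * (\<Sum>i\<in>UNIV. norm (\<psi> (idx i)))"
      by (simp add: sum_distrib_left)
  qed
  then show ?thesis
    by unfold_locales (simp_all add: vec_eq_iff modal_vector_def ip_add_left ip_scaleR_left)
qed

lemma \<theta>_range: "t \<ge> - D \<Longrightarrow> 0 \<le> \<theta> t" "t \<ge> - D \<Longrightarrow> \<theta> t \<le> 1"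
  and \<theta>_0: "t \<in> {- D..0} \<Longrightarrow> \<theta> t = 0" and \<theta>_1: "t \<ge> t0 \<Longrightarrow> \<theta> t = 1"
  using \<theta> by (auto simp: transition_signal_def)

text \<open>The derivative is continuous on the compact \<open>{- D..t0}\<close> and zero
  afterwards, hence bounded. It vanishes even at the end 0 of the rest interval, because the
  one-sided derivative there is unique; this permits gluing \<open>u'\<close> at time 0.\<close>

lemma \<theta>_derivative:
  obtains \<theta>' C where "\<And>t. t \<ge> - D \<Longrightarrow> (\<theta> has_vector_derivative \<theta>' t) (at t within {- D..})"
    "\<And>t. t \<in> {- D..0} \<Longrightarrow> \<theta>' t = 0" "C \<ge> 0" "\<And>t. t \<ge> - D \<Longrightarrow> \<bar>\<theta>' t\<bar> \<le> C"
proof -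
  obtain \<theta>' where \<theta>': "\<And>t. t \<ge> - D \<Longrightarrow> (\<theta> has_vector_derivative \<theta>' t) (at t within {- D..})"
    and "C1_on {- D..} \<theta>'"
    using \<theta> by (auto simp: transition_signal_def C2_on_def)
  then obtain \<theta>'' where "\<And>t. t \<ge> - D \<Longrightarrow> (\<theta>' has_vector_derivative \<theta>'' t) (at t within {- D..})"
    by (auto simp: C1_on_def)
  then have cont: "continuous_on {- D..} \<theta>'"
    by (meson atLeast_iff continuous_on_vector_derivative)
  have const: "\<theta>' t = 0" if "{a..b} \<subseteq> {- D..}" "a < b" "t \<in> {a..b}" "\<And>s. s \<in> {a..b} \<Longrightarrow> \<theta> s = c" for a b c t
  proof -
    have "(\<theta> has_vector_derivative \<theta>' t) (at t within {a..b})"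
      using \<theta>'[of t] that by (auto intro: has_vector_derivative_within_subset)
    moreover have "(\<theta> has_vector_derivative 0) (at t within {a..b})"
      by (rule has_vector_derivative_transform[OF \<open>t \<in> {a..b}\<close> _ has_vector_derivative_const[of c]])
        (use that in auto)
    ultimately show ?thesis
      using vector_derivative_unique_within_closed_interval[of a b t \<theta>] that by auto
  qed
  have zero: "\<theta>' t = 0" if "t \<in> {- D..0}" for t
    by (rule const[of "- D" 0 t 0]) (use that D \<theta>_0 in auto)
  have zero': "\<theta>' t = 0" if "t \<ge> t0" for t
    by (rule const[of t "t + 1" t 1]) (use that t0 D \<theta>_1 in auto)
  have "compact (\<theta>' ` {- D..t0})"
    by (intro compact_continuous_image continuous_on_subset[OF cont]) auto
  then obtain C where C: "\<And>t. t \<in> {- D..t0} \<Longrightarrow> norm (\<theta>' t) \<le> C"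
    by (meson bounded_iff compact_imp_bounded imageI)
  show thesis
  proof (rule that[OF \<theta>' zero, of "max C 0"])
    show "\<bar>\<theta>' t\<bar> \<le> max C 0" if "t \<ge> - D" for t
      using C[of t] zero'[of t] that by (cases "t \<le> t0") auto
  qed auto
qed

section \<open>Regularity and dynamics of a single closed-loop trajectory\<close>

context
  fixes X0 d X u
  assumes run: "run X0 d X u"
begin

lemma X_props: "t \<ge> 0 \<Longrightarrow> X t \<in> DA" "continuous_on {0..} X"
    "t \<ge> 0 \<Longrightarrow> (X has_vector_derivative A (X t) + d t) (at t within {0..})"
    "t \<ge> 0 \<Longrightarrow> Bd (X t) = u (t - D)" "X 0 = X0"
  and u_0: "t \<in> {- D..0} \<Longrightarrow> u t = 0"
  and kernel_integrable:
    "t \<ge> 0 \<Longrightarrow> (\<lambda>s. (matexp ((t - s - D) *\<^sub>R AN) ** BN) *v u s) integrable_on {max (t - D) 0..t}"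
  using run by (simp_all add: run_def closed_loop_solution_def)

lemma feedback: "t \<ge> 0 \<Longrightarrow> u t = \<theta> t *\<^sub>R (K *v artstein X u t)"
  using run by (simp add: run_def closed_loop_solution_def artstein_def matrix_vector_right_distrib scaleR_right_distrib)

text \<open>The part of the predictor kernel that depends on \<open>s\<close> alone, once
  \<open>exp ((t - D) *\<^sub>R lam (idx i))\<close> is pulled out. The integral over the moving
  window becomes a difference of values of one primitive, which can be differentiated in
  \<open>t\<close>.\<close>

definition history :: "'n \<Rightarrow> real \<Rightarrow> 'k"
  where "history i s = exp ((- s) *\<^sub>R lam (idx i)) * (BN *v u s) $ i"

lemma kernel_nth:
  "((matexp ((t - s - D) *\<^sub>R AN) ** BN) *v u s) $ i = exp ((t - D) *\<^sub>R lam (idx i)) * history i s"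
proof -
  have "(t - s - D) *\<^sub>R lam (idx i) = (t - D) *\<^sub>R lam (idx i) + (- s) *\<^sub>R lam (idx i)"
    by (simp add: algebra_simps)
  then show ?thesis
    unfolding AN matexp_A_trunc history_def by (simp only: exp_add mult.assoc)
qed

lemma history_integrable_window:
  assumes "t \<ge> 0"
  shows "history i integrable_on {max (t - D) 0..t}"
proof -
  have "(\<lambda>s. exp ((t - D) *\<^sub>R lam (idx i)) * history i s) integrable_on {max (t - D) 0..t}"
    using integrable_linear[OF kernel_integrable[OF assms] bounded_linear_vec_nth[of i]]
    by (simp add: o_def kernel_nth)
  from integrable_linear[OF this bounded_linear_mult_right[of "inverse (exp ((t - D) *\<^sub>R lam (idx i)))"]]
  show ?thesis by (simp add: o_def mult.assoc[symmetric])
qed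

text \<open>Integrability is assumed only on windows of length at most \<open>D\<close>. Those
  ending at multiples of \<open>D\<close> are glued, and on \<open>{- D..0}\<close> the control is
  zero.\<close>

lemma history_integrable: "history i integrable_on {- D..T}"
proof -
  have *: "history i integrable_on {0..real n * D}" for n
  proof (induction n)
    case (Suc n)
    have "max (real (Suc n) * D - D) 0 = real n * D" using D by (simp add: algebra_simps)
    then have "history i integrable_on {real n * D..real (Suc n) * D}"
      using history_integrable_window[of "real (Suc n) * D" i] D by simp
    then show ?case
      using D by (intro Henstock_Kurzweil_Integration.integrable_combine[OF _ _ Suc.IH]) (auto simp: mult_right_mono)
  qed (use integrable_on_refl[of "history i" "0::real"] in simp)
  obtain n where n: "T < real n * D" using D reals_Archimedean3 by blast
  have "history i s = 0" if "s \<in> {- D..0}" for s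
    using u_0[OF that] by (simp add: history_def)
  then have "history i integrable_on {- D..0}"
    by (intro integrable_eq[OF integrable_0]) auto
  then have "history i integrable_on {- D..real n * D}"
    by (rule Henstock_Kurzweil_Integration.integrable_combine[rotated 2, OF _ *]) (use D in simp_all)
  moreover have "{- D..T} \<subseteq> {- D..real n * D}" using n by (intro atLeastatMost_subset_iff[THEN iffD2]) simp
  ultimately show ?thesis by (rule integrable_on_subinterval)
qed

lemma artstein_nth:
  assumes "t \<ge> 0"
  shows "artstein X u t $ i = ip (X t) (\<psi> (idx i)) +
    exp ((t - D) *\<^sub>R lam (idx i)) * (integral {- D..t} (history i) - integral {- D..t - D} (history i))"
proof -
  let ?m = "max (t - D) 0"
  have m: "integral {- D..?m} (history i) = integral {- D..t - D} (history i)"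
  proof (cases "t - D \<ge> 0")
    case False
    have z: "integral {- D..s} (history i) = 0" if "s \<le> 0" for s
      by (rule integral_unique, rule has_integral_is_0) (use that u_0 in \<open>auto simp: history_def\<close>)
    show ?thesis using False by (simp add: z)
  qed simp
  have "integral {?m..t} (\<lambda>s. (matexp ((t - s - D) *\<^sub>R AN) ** BN) *v u s) $ i
      = integral {?m..t} (\<lambda>s. ((matexp ((t - s - D) *\<^sub>R AN) ** BN) *v u s) $ i)"
    using integral_linear[OF kernel_integrable[OF assms] bounded_linear_vec_nth[of i]] by (simp add: o_def)
  also have "\<dots> = exp ((t - D) *\<^sub>R lam (idx i)) * integral {?m..t} (history i)"
    using integral_linear[OF history_integrable_window[OF assms, of i] bounded_linear_mult_right[of "exp ((t - D) *\<^sub>R lam (idx i))"]]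
    by (simp add: o_def kernel_nth)
  also have "integral {?m..t} (history i) = integral {- D..t} (history i) - integral {- D..?m} (history i)"
    using Henstock_Kurzweil_Integration.integral_combine[OF _ _ history_integrable, of "?m" t i] D assms
    by (simp add: algebra_simps)
  finally show ?thesis unfolding m by (simp add: artstein_def modal_vector_def)
qed

lemma continuous_history_integral: "continuous_on {- D..} (\<lambda>t. integral {- D..t} (history i))"
  by (rule continuous_on_atLeastI[of "- D"]) (rule indefinite_integral_continuous_1[OF history_integrable])

lemma continuous_delayed: "continuous_on {- D..} f \<Longrightarrow> continuous_on {0..} (\<lambda>t. f (t - D))"
  by (rule continuous_on_compose2[of "{- D..}"]) (auto intro!: continuous_intros)

text \<open>Start of the bootstrap: primitives of integrable functions are continuous, so the
  Artstein variable is, hence \<open>u\<close> by the feedback law, hence \<open>history\<close>,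
  whose primitive is then differentiable.\<close>

lemma continuous_artstein: "continuous_on {0..} (artstein X u)"
proof -
  have "continuous_on {0..} (\<lambda>t. \<chi> i. ip (X t) (\<psi> (idx i)) +
    exp ((t - D) *\<^sub>R lam (idx i)) * (integral {- D..t} (history i) - integral {- D..t - D} (history i)))"
    using X_props(2) continuous_history_integral D
    by (intro continuous_intros continuous_delayed[where f = "\<lambda>t. integral {- D..t} (history i)" for i]
        continuous_on_subset[OF continuous_history_integral]) auto
  then show ?thesis
    by (rule continuous_on_eq) (simp add: vec_eq_iff artstein_nth)
qed

lemma continuous_u: "continuous_on {- D..} u"
proof -
  have "continuous_on {- D..} \<theta>"
    using \<theta> by (auto simp: transition_signal_def C2_on_def intro: continuous_on_vector_derivative)
  then have "continuous_on {0..} \<theta>" using D by (elim continuous_on_subset) auto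
  then have "continuous_on {0..} (\<lambda>t. \<theta> t *\<^sub>R (K *v artstein X u t))"
    by (intro continuous_intros bounded_linear.continuous_on[OF bounded_linear_matrix_vector] continuous_artstein)
  then have "continuous_on {0..} u" by (rule continuous_on_eq) (simp add: feedback)
  moreover have "continuous_on {- D..0} u"
    by (rule continuous_on_eq[OF continuous_on_const[of _ 0]]) (simp add: u_0)
  ultimately have "continuous_on ({- D..0} \<union> {0..}) u"
    by (intro continuous_on_closed_Un) auto
  moreover have "{- D..0} \<union> {0..} = {- D..}" using D by auto
  ultimately show ?thesis by simp
qed

lemma continuous_history: "continuous_on {- D..} (history i)"
  unfolding history_def
  by (intro continuous_intros continuous_on_component
      bounded_linear.continuous_on[OF bounded_linear_matrix_vector] continuous_u)

text \<open>\<open>X t - L (u (t - D))\<close> lies in the domain of the generator, which gives the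
  terms with \<open>lam n\<close>. For \<open>n = idx i\<close> the bracket is component
  \<open>i\<close> of \<open>BN\<close> applied to the delayed input.\<close>

lemma coordinate_derivative:
  assumes "t \<ge> 0" "n \<ge> 1"
  shows "((\<lambda>t. ip (X t) (\<psi> n)) has_vector_derivative
    lam n * ip (X t) (\<psi> n) + (- lam n * ip (L (u (t - D))) (\<psi> n) + ip (A (L (u (t - D)))) (\<psi> n)) + ip (d t) (\<psi> n))
    (at t within {0..})"
proof -
  note X = X_props(1,4)[OF assms(1)]
  have "ip (A (X t)) (\<psi> n) = lam n * ip (X t - L (u (t - D))) (\<psi> n) + ip (A (L (u (t - D)))) (\<psi> n)"
    using lifted_in_dom0[OF X(1)] generator_coordinate0[of "X t - L (u (t - D))" n] assms X
    by (simp add: ip_add_left)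
  then have "ip (A (X t) + d t) (\<psi> n) = lam n * ip (X t) (\<psi> n)
      + (- lam n * ip (L (u (t - D))) (\<psi> n) + ip (A (L (u (t - D)))) (\<psi> n)) + ip (d t) (\<psi> n)"
    by (simp add: ip_add_left linear_diff[OF ip_linear] algebra_simps)
  moreover have "((\<lambda>t. ip (X t) (\<psi> n)) has_vector_derivative ip (A (X t) + d t) (\<psi> n)) (at t within {0..})"
    by (rule bounded_linear.has_vector_derivative[OF bounded_linear_ip X_props(3)[OF assms(1)]])
  ultimately show ?thesis by simp
qed

text \<open>The lower end of the window contributes the delayed input with a minus sign and cancels
  it in the coordinate equation; the upper end contributes \<open>EB\<close> applied to
  \<open>u t\<close>. The factor in front of the integral restores \<open>AN\<close> acting on the
  whole variable.\<close>

lemma artstein_derivative: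
  assumes t: "t \<ge> 0"
  shows "(artstein X u has_vector_derivative
    AN *v artstein X u t + \<theta> t *\<^sub>R (EB *v (K *v artstein X u t)) + modal (d t)) (at t within {0..})"
proof (rule has_vector_derivative_vecI)
  fix i
  let ?l = "lam (idx i)"
  let ?J = "\<lambda>t. integral {- D..t} (history i)"
  let ?q = "\<lambda>t. (BN *v u t) $ i"
  have J: "(?J has_vector_derivative history i s) (at s within {- D..})" if "s \<ge> - D" for s
    by (rule integral_has_vector_derivative_atLeast[OF continuous_history that])
  have JD: "((\<lambda>t. ?J (t - D)) has_vector_derivative history i (t - D)) (at t within {0..})"
    by (rule has_vector_derivative_shift[OF J]) (use t in simp)
  have J0: "(?J has_vector_derivative history i t) (at t within {0..})"
    by (rule has_vector_derivative_within_subset[OF J]) (use t D in auto)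
  have "((\<lambda>t. exp ((- D) *\<^sub>R ?l) * exp (t *\<^sub>R ?l)) has_vector_derivative
      exp ((- D) *\<^sub>R ?l) * (exp (t *\<^sub>R ?l) * ?l)) (at t within {0..})"
    by (rule bounded_linear.has_vector_derivative[OF bounded_linear_mult_right exp_scaleR_has_vector_derivative_right])
  then have E: "((\<lambda>t. exp ((t - D) *\<^sub>R ?l)) has_vector_derivative exp ((t - D) *\<^sub>R ?l) * ?l) (at t within {0..})"
    by (simp add: exp_add[symmetric] mult.assoc[symmetric] scaleR_left_diff_distrib)
  have now: "exp ((t - D) *\<^sub>R ?l) * history i t = exp ((- D) *\<^sub>R ?l) * ?q t"
    and past: "exp ((t - D) *\<^sub>R ?l) * history i (t - D) = ?q (t - D)"
    unfolding history_def mult.assoc[symmetric] exp_add[symmetric]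
    by (simp_all add: scaleR_left_diff_distrib)
  have diag: "(AN *v artstein X u t) $ i = ?l * artstein X u t $ i"
    by (simp add: AN A_trunc_def diagonal_matrix_vector)
  have "\<theta> t *\<^sub>R (EB *v (K *v artstein X u t)) = EB *v u t"
    using linear_scale[OF bounded_linear.linear[OF bounded_linear_matrix_vector], of EB "\<theta> t" "K *v artstein X u t"]
      feedback[OF t] by simp
  then have input: "(\<theta> t *\<^sub>R (EB *v (K *v artstein X u t))) $ i = exp ((- D) *\<^sub>R ?l) * ?q t"
    by (simp only: EB_nth)
  have eq: "(?l * ip (X t) (\<psi> (idx i)) + ?q (t - D) + ip (d t) (\<psi> (idx i))) +
      (exp ((t - D) *\<^sub>R ?l) * (history i t - history i (t - D)) + (exp ((t - D) *\<^sub>R ?l) * ?l) * (?J t - ?J (t - D)))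
    = (AN *v artstein X u t + \<theta> t *\<^sub>R (EB *v (K *v artstein X u t)) + modal (d t)) $ i"
    unfolding vector_add_component diag input artstein_nth[OF t] modal_vector_def vec_lambda_beta
      right_diff_distrib[of _ "history i t"] now past
    by (simp add: algebra_simps)
  have "((\<lambda>t. ip (X t) (\<psi> (idx i)) + exp ((t - D) *\<^sub>R ?l) * (?J t - ?J (t - D))) has_vector_derivative
      (AN *v artstein X u t + \<theta> t *\<^sub>R (EB *v (K *v artstein X u t)) + modal (d t)) $ i) (at t within {0..})"
    unfolding eq[symmetric] unfolding BN_mult
    by (intro has_vector_derivative_add has_vector_derivative_mult has_vector_derivative_diff E J0 JD
        coordinate_derivative t idx_ge_1)
  then show "((\<lambda>t. artstein X u t $ i) has_vector_derivative
      (AN *v artstein X u t + \<theta> t *\<^sub>R (EB *v (K *v artstein X u t)) + modal (d t)) $ i) (at t within {0..})"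
    by (rule has_vector_derivative_transform[rotated 2]) (use t artstein_nth in auto)
qed

lemma artstein_0: "artstein X u 0 = modal X0"
  using D by (simp add: artstein_def X_props)

end

section \<open>Decay of the Artstein variable\<close>

lemma AN_EB_K_bound:
  obtains C where "C \<ge> 0" "\<And>r z. 0 \<le> r \<Longrightarrow> r \<le> 1 \<Longrightarrow> norm (AN *v z + r *\<^sub>R (EB *v (K *v z))) \<le> C * norm z"
proof -
  obtain C1 where C1: "C1 \<ge> 0" "\<And>z. norm (AN *v z) \<le> C1 * norm z"
    using bounded_linear_norm_bound[OF bounded_linear_matrix_vector] by blast
  obtain C2 where C2: "C2 \<ge> 0" "\<And>z. norm (EB *v (K *v z)) \<le> C2 * norm z"
    using bounded_linear_norm_bound[OF bounded_linear_compose[OF bounded_linear_matrix_vector bounded_linear_matrix_vector]]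
    by blast
  show thesis
  proof (rule that[of "C1 + C2"])
    fix r :: real and z assume r: "0 \<le> r" "r \<le> 1"
    have "r * norm (EB *v (K *v z)) \<le> 1 * (C2 * norm z)" by (intro mult_mono r C2) auto
    then have "norm (r *\<^sub>R (EB *v (K *v z))) \<le> C2 * norm z" using r by simp
    then show "norm (AN *v z + r *\<^sub>R (EB *v (K *v z))) \<le> (C1 + C2) * norm z"
      using C1(2)[of z] norm_triangle_ineq[of "AN *v z" "r *\<^sub>R (EB *v (K *v z))"]
      by (simp add: distrib_right)
  qed (use C1 C2 in simp)
qed

lemma artstein_derivative_on:
  assumes "run X0 d X u" "t \<in> {0..T}"
  shows "(artstein X u has_vector_derivative
    AN *v artstein X u t + \<theta> t *\<^sub>R (EB *v (K *v artstein X u t)) + modal (d t)) (at t within {0..T})"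
  by (rule has_vector_derivative_within_subset[OF artstein_derivative[OF assms(1)]]) (use assms in auto)

lemma artstein_transient_bound:
  obtains C where "C \<ge> 0"
    "\<And>X0 d X u T b t. \<lbrakk>run X0 d X u; b \<ge> 0; \<And>t. t \<in> {0..T} \<Longrightarrow> norm (d t) \<le> b; t \<in> {0..T}; t \<le> t0\<rbrakk>
      \<Longrightarrow> norm (artstein X u t) \<le> C * (norm X0 + b)"
proof -
  obtain P where P: "P \<ge> 0" "\<And>x. norm (modal x) \<le> P * norm x"
    using bounded_linear_norm_bound[OF bounded_linear_modal] by blast
  obtain c where c: "c \<ge> 0"
    "\<And>r z. 0 \<le> r \<Longrightarrow> r \<le> 1 \<Longrightarrow> norm (AN *v z + r *\<^sub>R (EB *v (K *v z))) \<le> c * norm z"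
    by (fact AN_EB_K_bound)
  \<comment> \<open>In the inequality for the squared norm, \<open>2 * c\<close> comes from the
    matrix and 1 from Young's inequality for the disturbance term.\<close>
  define p where "p = 2 * c + 1"
  have p: "p \<ge> 1" using c by (simp add: p_def)
  show thesis
  proof (rule that[of "P * exp (p * t0)"])
    fix X0 d X u T b t
    assume run: "run X0 d X u" and b: "b \<ge> 0" and d: "\<And>t. t \<in> {0..T} \<Longrightarrow> norm (d t) \<le> b"
      and t: "t \<in> {0..T}" "t \<le> t0"
    \<comment> \<open>A growing comparison function with rate \<open>p\<close>; its prefactor
      dominates both the initial norm and the disturbance bound.\<close>
    define h where "h s = (norm X0 + b) * exp (p * s)" for s
    have h0: "h s \<ge> 0" for s using b by (simp add: h_def)
    let ?Z = "artstein X u"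
    let ?Z' = "\<lambda>t. AN *v ?Z t + \<theta> t *\<^sub>R (EB *v (K *v ?Z t)) + modal (d t)"
    have v: "((\<lambda>t. (norm (cvec (?Z t)))\<^sup>2) has_real_derivative 2 * (cvec (?Z s) \<bullet> cvec (?Z' s))) (at s within {0..T})"
      if "s \<in> {0..T}" for s
      by (rule norm_square_has_derivative[OF bounded_linear.has_vector_derivative[OF bounded_linear_cvec
              artstein_derivative_on[OF run that]]])
    have "(norm (cvec (?Z t)))\<^sup>2 \<le> P\<^sup>2 * (h t)\<^sup>2"
    proof (rule comparison_square[OF v, where h' = "\<lambda>s. p * h s" and p = p and \<rho> = p and q = "P\<^sup>2"])
      fix s assume s: "s \<in> {0..T}"
      show "(h has_real_derivative p * h s) (at s within {0..T})"
        unfolding h_def by (auto intro!: derivative_eq_intros)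
      show "h s \<ge> 0" by (rule h0)
      have "b * 1 \<le> (norm X0 + b) * exp (p * s)" using b s p by (intro mult_mono) auto
      then have bh: "b \<le> h s" by (simp add: h_def)
      have "norm (modal (d s)) \<le> P * h s"
        using P(2)[of "d s"] mult_left_mono[OF order_trans[OF d[OF s] bh] P(1)] by linarith
      moreover have "norm (AN *v ?Z s + \<theta> s *\<^sub>R (EB *v (K *v ?Z s))) \<le> c * norm (?Z s)"
        using \<theta>_range[of s] s D by (intro c(2)) auto
      ultimately have "norm (cvec (?Z' s)) \<le> c * norm (?Z s) + P * h s"
        unfolding norm_cvec using norm_triangle_ineq[of "AN *v ?Z s + \<theta> s *\<^sub>R (EB *v (K *v ?Z s))" "modal (d s)"]
        by linarith
      then have "norm (cvec (?Z s)) * norm (cvec (?Z' s)) \<le> norm (?Z s) * (c * norm (?Z s) + P * h s)"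
        unfolding norm_cvec by (rule mult_left_mono) simp
      then have "2 * (cvec (?Z s) \<bullet> cvec (?Z' s)) \<le> 2 * c * (norm (?Z s))\<^sup>2 + 2 * norm (?Z s) * (P * h s)"
        using norm_cauchy_schwarz[of "cvec (?Z s)" "cvec (?Z' s)"] by (simp add: power2_eq_square algebra_simps)
      moreover have "2 * norm (?Z s) * (P * h s) \<le> (norm (?Z s))\<^sup>2 + (P * h s)\<^sup>2"
        using two_mult_le_scaled_squares[of 1 "norm (?Z s)" "P * h s"] by simp
      ultimately show "2 * (cvec (?Z s) \<bullet> cvec (?Z' s)) \<le> p * (norm (cvec (?Z s)))\<^sup>2 + P\<^sup>2 * (h s)\<^sup>2"
        by (simp add: p_def power_mult_distrib algebra_simps)
    next
      have "P * norm X0 \<le> P * (norm X0 + b)" using P(1) b by (intro mult_left_mono) auto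
      then have "norm (cvec (?Z 0)) \<le> P * h 0"
        using P(2)[of X0] by (simp add: artstein_0[OF run] h_def)
      then have "(norm (cvec (?Z 0)))\<^sup>2 \<le> (P * h 0)\<^sup>2" by (intro power_mono) auto
      then show "(norm (cvec (?Z 0)))\<^sup>2 \<le> P\<^sup>2 * (h 0)\<^sup>2" by (simp add: power_mult_distrib)
      have "P\<^sup>2 * 1 \<le> P\<^sup>2 * p" using p by (intro mult_left_mono) auto
      then show "P\<^sup>2 \<le> P\<^sup>2 * (2 * p - p)" by simp
    qed (use t in auto)
    then have "(norm (?Z t))\<^sup>2 \<le> (P * h t)\<^sup>2" by (simp add: power_mult_distrib)
    then have "norm (?Z t) \<le> P * h t" by (rule power2_le_imp_le) (simp add: P(1) h0)
    also have "\<dots> \<le> P * ((norm X0 + b) * exp (p * t0))"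
      unfolding h_def using t p b by (intro mult_left_mono P(1)) auto
    finally show "norm (?Z t) \<le> P * exp (p * t0) * (norm X0 + b)" by (simp add: mult_ac)
  qed (use P in simp)
qed

text \<open>The bound \<open>b\<close> is any bound of \<open>d\<close> on \<open>{0..T}\<close>;
  \<open>\<kappa>\<close> and \<open>C\<close> come before all trajectories.\<close>

definition artstein_controlled :: "real \<Rightarrow> real \<Rightarrow> bool"
  where "artstein_controlled \<kappa> C \<longleftrightarrow> (\<forall>X0 d X u T b t. run X0 d X u \<longrightarrow> b \<ge> 0 \<longrightarrow>
    (\<forall>t\<in>{0..T}. norm (d t) \<le> b) \<longrightarrow> t \<in> {0..T} \<longrightarrow>
    norm (artstein X u t) \<le> C * envelope \<kappa> (norm X0) b t)"

text \<open>The system is read as the Hurwitz one with the extra forcing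
  \<open>(\<theta> - 1) EB K Z\<close>. That forcing is zero after \<open>t0\<close>; before
  \<open>t0\<close> the transient estimate bounds it, at the cost of
  \<open>exp (\<kappa> * t0)\<close> to fit under the envelope. Capping the rate by
  \<open>\<alpha> / 2\<close> prepares for the damped modes.\<close>

lemma artstein_bound:
  obtains \<kappa> C where "\<kappa> > 0" "2 * \<kappa> \<le> \<alpha>" "C \<ge> 0" "artstein_controlled \<kappa> C"
proof -
  define M where "M = cmat (AN + EB ** K)"
  have stable: "Re z < 0" if "v \<noteq> 0" "M *v v = z *s v" for z v
    using K that by (auto simp: hurwitz_def M_def cmat_def EB_def)
  obtain \<kappa> C where \<kappa>: "\<kappa> > 0" "\<kappa> \<le> \<alpha> / 2" and C: "C \<ge> 0" and
    decay: "\<And>T a b y g t. \<lbrakk>a \<ge> 0; b \<ge> 0;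
      \<And>t. t \<in> {0..T} \<Longrightarrow> (y has_vector_derivative M *v y t + g t) (at t within {0..T});
      \<And>t. t \<in> {0..T} \<Longrightarrow> norm (g t) \<le> envelope \<kappa> a b t;
      norm (y 0) \<le> a + b; t \<in> {0..T}\<rbrakk> \<Longrightarrow> norm (y t) \<le> C * envelope \<kappa> a b t"
    using hurwitz_matrix_decay[of M "\<alpha> / 2"] stable A2(1) by (metis half_gt_zero)
  obtain Q where Q: "Q \<ge> 0" "\<And>X0 d X u T b t. \<lbrakk>run X0 d X u; b \<ge> 0;
      \<And>t. t \<in> {0..T} \<Longrightarrow> norm (d t) \<le> b; t \<in> {0..T}; t \<le> t0\<rbrakk>
      \<Longrightarrow> norm (artstein X u t) \<le> Q * (norm X0 + b)"
    by (fact artstein_transient_bound)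
  obtain P where P: "P \<ge> 0" "\<And>x. norm (modal x) \<le> P * norm x"
    using bounded_linear_norm_bound[OF bounded_linear_modal] by blast
  obtain R where R: "R \<ge> 0" "\<And>z. norm (EB *v (K *v z)) \<le> R * norm z"
    using bounded_linear_norm_bound[OF bounded_linear_compose[OF bounded_linear_matrix_vector bounded_linear_matrix_vector]]
    by blast
  define c where "c = R * (Q * exp (\<kappa> * t0)) + P"
  have c: "c \<ge> P" "c \<ge> 0" using R Q P by (auto simp: c_def)
  have "artstein_controlled \<kappa> (C * c)"
    unfolding artstein_controlled_def
  proof (intro allI impI)
    fix X0 d X u T b t
    assume run: "run X0 d X u" and b: "b \<ge> 0" and "\<forall>t\<in>{0..T}. norm (d t) \<le> b"
      and t: "t \<in> {0..T}"
    then have d: "\<And>t. t \<in> {0..T} \<Longrightarrow> norm (d t) \<le> b" by blast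
    let ?Z = "artstein X u"
    let ?E = "envelope \<kappa> (norm X0) b"
    have E0: "?E s \<ge> 0" for s using b by (simp add: envelope_nonneg)
    define g where "g s = (\<theta> s - 1) *\<^sub>R (EB *v (K *v ?Z s)) + modal (d s)" for s
    have "norm (cvec (?Z t)) \<le> C * envelope \<kappa> (c * norm X0) (c * b) t"
    proof (rule decay)
      fix s assume s: "s \<in> {0..T}"
      have "AN *v ?Z s + \<theta> s *\<^sub>R (EB *v (K *v ?Z s)) + modal (d s) = (AN + EB ** K) *v ?Z s + g s"
        by (simp add: g_def matrix_vector_mult_add_rdistrib matrix_vector_mul_assoc[symmetric] scaleR_left_diff_distrib)
      then have "cvec (AN *v ?Z s + \<theta> s *\<^sub>R (EB *v (K *v ?Z s)) + modal (d s)) = M *v cvec (?Z s) + cvec (g s)"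
        by (simp add: M_def cvec_mult linear_add[OF bounded_linear.linear[OF bounded_linear_cvec]])
      then show "((\<lambda>t. cvec (?Z t)) has_vector_derivative M *v cvec (?Z s) + cvec (g s)) (at s within {0..T})"
        using bounded_linear.has_vector_derivative[OF bounded_linear_cvec artstein_derivative_on[OF run s]] by simp
      have "norm ((\<theta> s - 1) *\<^sub>R (EB *v (K *v ?Z s))) \<le> R * (Q * exp (\<kappa> * t0)) * ?E s"
      proof (cases "s \<le> t0")
        case True
        have "norm X0 + b = envelope \<kappa> (norm X0) b 0" by (simp add: envelope_def)
        also have "\<dots> \<le> exp (\<kappa> * t0) * ?E s"
          using \<kappa> b s True by (intro envelope_shift) auto
        finally have "norm (?Z s) \<le> Q * (exp (\<kappa> * t0) * ?E s)"
          using Q(2)[OF run b d s True] mult_left_mono[OF _ Q(1)] by (meson order_trans)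
        then have "norm (EB *v (K *v ?Z s)) \<le> R * (Q * (exp (\<kappa> * t0) * ?E s))"
          using R(2)[of "?Z s"] mult_left_mono[OF _ R(1)] by (meson order_trans)
        moreover have "\<bar>\<theta> s - 1\<bar> \<le> 1" using \<theta>_range[of s] s D by auto
        ultimately have "\<bar>\<theta> s - 1\<bar> * norm (EB *v (K *v ?Z s)) \<le> 1 * (R * (Q * (exp (\<kappa> * t0) * ?E s)))"
          by (intro mult_mono) auto
        then show ?thesis by (simp add: mult.assoc)
      next
        case False
        then show ?thesis using \<theta>_1[of s] R Q E0[of s] by simp
      qed
      moreover have "norm (modal (d s)) \<le> P * ?E s"
      proof -
        have "norm (d s) \<le> ?E s" using d[OF s] b by (simp add: envelope_def add_increasing)
        then show ?thesis using P(2)[of "d s"] mult_left_mono[OF _ P(1)] by (meson order_trans)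
      qed
      ultimately have "norm (g s) \<le> c * ?E s"
        unfolding g_def c_def distrib_right by (intro norm_triangle_le add_mono)
      then show "norm (cvec (g s)) \<le> envelope \<kappa> (c * norm X0) (c * b) s"
        by (simp add: envelope_scale)
    next
      have "P * norm X0 \<le> c * norm X0" using c by (intro mult_right_mono) auto
      then show "norm (cvec (?Z 0)) \<le> c * norm X0 + c * b"
        using P(2)[of X0] c b by (simp add: artstein_0[OF run] add_increasing2)
    qed (use c b t in auto)
    then show "norm (?Z t) \<le> C * c * ?E t" by (simp add: envelope_scale mult.assoc)
  qed
  then show thesis using \<kappa> C c by (intro that[of \<kappa> "C * c"]) auto
qed

section \<open>From the Artstein variable to the control and the state\<close>

context
  fixes \<kappa> CZ
  assumes \<kappa>: "\<kappa> > 0" "2 * \<kappa> \<le> \<alpha>" and CZ: "CZ \<ge> 0"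
    and controlled: "artstein_controlled \<kappa> CZ"
begin

lemmas Z_bound = controlled[unfolded artstein_controlled_def, rule_format]

lemma u_bound:
  obtains C where "C \<ge> 0"
    "\<And>X0 d X u T b t. \<lbrakk>run X0 d X u; b \<ge> 0; \<And>t. t \<in> {0..T} \<Longrightarrow> norm (d t) \<le> b; t \<in> {- D..T}\<rbrakk>
      \<Longrightarrow> norm (u t) \<le> C * envelope \<kappa> (norm X0) b t"
proof -
  obtain R where R: "R \<ge> 0" "\<And>z. norm (K *v z) \<le> R * norm z"
    using bounded_linear_norm_bound[OF bounded_linear_matrix_vector] by blast
  show thesis
  proof (rule that[of "R * CZ"])
    fix X0 d X u T b t
    assume run: "run X0 d X u" and b: "b \<ge> 0" and d: "\<And>t. t \<in> {0..T} \<Longrightarrow> norm (d t) \<le> b"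
      and t: "t \<in> {- D..T}"
    let ?E = "envelope \<kappa> (norm X0) b"
    show "norm (u t) \<le> R * CZ * ?E t"
    proof (cases "t \<le> 0")
      case True
      then show ?thesis using u_0[OF run] t R CZ b by (simp add: envelope_nonneg)
    next
      case False
      then have "norm (K *v artstein X u t) \<le> R * (CZ * ?E t)"
        using R(2)[of "artstein X u t"] mult_left_mono[OF Z_bound[OF run b d] R(1)] t by (force intro: order_trans)
      moreover have "\<bar>\<theta> t\<bar> \<le> 1" using \<theta>_range t by auto
      ultimately have "\<bar>\<theta> t\<bar> * norm (K *v artstein X u t) \<le> 1 * (R * (CZ * ?E t))"
        by (intro mult_mono) auto
      then show ?thesis using feedback[OF run, of t] False by (simp add: mult.assoc)
    qed
  qed (use R CZ in simp)
qed

text \<open>By the product rule \<open>u'\<close> is expressed through \<open>\<theta>'\<close>, the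
  Artstein variable and its derivative. The latter is read off its differential equation and is thus
  bounded by the same envelope.\<close>

lemma u_derivative_bound:
  obtains C where "C \<ge> 0"
    "\<And>X0 d X u T b. \<lbrakk>run X0 d X u; b \<ge> 0; \<And>t. t \<in> {0..T} \<Longrightarrow> norm (d t) \<le> b\<rbrakk>
      \<Longrightarrow> \<exists>u'. \<forall>t\<in>{- D..T}. (u has_vector_derivative u' t) (at t within {- D..}) \<and>
        norm (u' t) \<le> C * envelope \<kappa> (norm X0) b t"
proof -
  obtain R where R: "R \<ge> 0" "\<And>z. norm (K *v z) \<le> R * norm z"
    using bounded_linear_norm_bound[OF bounded_linear_matrix_vector] by blast
  obtain P where P: "P \<ge> 0" "\<And>x. norm (modal x) \<le> P * norm x"
    using bounded_linear_norm_bound[OF bounded_linear_modal] by blast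
  obtain c where c: "c \<ge> 0"
    "\<And>r z. 0 \<le> r \<Longrightarrow> r \<le> 1 \<Longrightarrow> norm (AN *v z + r *\<^sub>R (EB *v (K *v z))) \<le> c * norm z"
    by (fact AN_EB_K_bound)
  obtain \<theta>' C where \<theta>': "\<And>t. t \<ge> - D \<Longrightarrow> (\<theta> has_vector_derivative \<theta>' t) (at t within {- D..})"
    "\<And>t. t \<in> {- D..0} \<Longrightarrow> \<theta>' t = 0" and C: "C \<ge> 0" "\<And>t. t \<ge> - D \<Longrightarrow> \<bar>\<theta>' t\<bar> \<le> C"
    by (fact \<theta>_derivative)
  define B where "B = C * (R * CZ) + R * (c * CZ + P)"
  show thesis
  proof (rule that[of B])
    show B: "B \<ge> 0" using C R CZ c P by (simp add: B_def)
    fix X0 d X u T b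
    assume run: "run X0 d X u" and b: "b \<ge> 0" and d: "\<And>t. t \<in> {0..T} \<Longrightarrow> norm (d t) \<le> b"
    let ?E = "envelope \<kappa> (norm X0) b"
    let ?Z = "artstein X u"
    let ?Z' = "\<lambda>t. AN *v ?Z t + \<theta> t *\<^sub>R (EB *v (K *v ?Z t)) + modal (d t)"
    \<comment> \<open>The value 0 at time 0 agrees with the product rule, as \<open>\<theta>\<close>
      and its derivative both vanish there; so this one function is the derivative from both
      sides.\<close>
    define u' where "u' t = (if t \<le> 0 then 0 else \<theta> t *\<^sub>R (K *v ?Z' t) + \<theta>' t *\<^sub>R (K *v ?Z t))" for t
    have right: "(u has_vector_derivative u' t) (at t within {0..})" if t: "t \<ge> 0" for t
    proof -
      have "(\<theta> has_vector_derivative \<theta>' t) (at t within {0..})"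
        by (rule has_vector_derivative_within_subset[OF \<theta>'(1)]) (use t D in auto)
      then have "((\<lambda>t. \<theta> t *\<^sub>R (K *v ?Z t)) has_vector_derivative
          \<theta> t *\<^sub>R (K *v ?Z' t) + \<theta>' t *\<^sub>R (K *v ?Z t)) (at t within {0..})"
        by (intro has_vector_derivative_scaleR[unfolded has_real_derivative_iff_has_vector_derivative]
            bounded_linear.has_vector_derivative[OF bounded_linear_matrix_vector artstein_derivative[OF run t]])
      moreover have "\<theta> t *\<^sub>R (K *v ?Z' t) + \<theta>' t *\<^sub>R (K *v ?Z t) = u' t"
        using t \<theta>'(2)[of 0] \<theta>_0[of 0] D by (auto simp: u'_def)
      ultimately have "((\<lambda>t. \<theta> t *\<^sub>R (K *v ?Z t)) has_vector_derivative u' t) (at t within {0..})"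
        by simp
      then show ?thesis
        by (rule has_vector_derivative_transform[rotated 2]) (use t feedback[OF run] in auto)
    qed
    have left: "(u has_vector_derivative u' t) (at t within {- D..0})" if t: "t \<in> {- D..0}" for t
      using t by (intro has_vector_derivative_transform[OF t _ has_vector_derivative_const[of 0, THEN back_subst[of "\<lambda>x. (_ has_vector_derivative x) _"]]])
        (auto simp: u'_def u_0[OF run])
    have deriv: "(u has_vector_derivative u' t) (at t within {- D..})" if t: "t \<ge> - D" for t
    proof -
      have "(u has_vector_derivative u' t) (at t within {- D..0} \<union> {0..})"
        using right[of t] left[of t] t
          has_vector_derivative_outside_closed[of "{0..}" t u "u' t"]
          has_vector_derivative_outside_closed[of "{- D..0}" t u "u' t"]
        by (intro has_vector_derivative_within_Un) force+
      moreover have "{- D..0} \<union> {0..} = {- D..}" using D by auto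
      ultimately show ?thesis by simp
    qed
    have bound: "norm (u' t) \<le> B * ?E t" if t: "t \<in> {- D..T}" for t
    proof (cases "t \<le> 0")
      case True
      then show ?thesis using B b by (simp add: u'_def envelope_nonneg)
    next
      case False
      then have t: "t \<in> {0..T}" "t \<ge> - D" using t D by auto
      note Z = Z_bound[OF run b d t(1)]
      have "norm (d t) \<le> ?E t" using d[OF t(1)] b by (simp add: envelope_def add_increasing)
      then have "norm (modal (d t)) \<le> P * ?E t"
        using P(2)[of "d t"] mult_left_mono[OF _ P(1)] by (meson order_trans)
      moreover have "norm (AN *v ?Z t + \<theta> t *\<^sub>R (EB *v (K *v ?Z t))) \<le> c * (CZ * ?E t)"
        using c(2)[OF \<theta>_range[OF t(2)], of "?Z t"] mult_left_mono[OF Z c(1)] by linarith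
      ultimately have "norm (?Z' t) \<le> c * (CZ * ?E t) + P * ?E t"
        by (rule norm_triangle_mono[rotated])
      then have "norm (?Z' t) \<le> (c * CZ + P) * ?E t" by (simp add: distrib_right mult.assoc)
      then have Z': "norm (K *v ?Z' t) \<le> R * ((c * CZ + P) * ?E t)"
        using R(2)[of "?Z' t"] mult_left_mono[OF _ R(1)] by (meson order_trans)
      have "\<bar>\<theta> t\<bar> * norm (K *v ?Z' t) \<le> 1 * (R * ((c * CZ + P) * ?E t))"
        using \<theta>_range[OF t(2)] Z' by (intro mult_mono) auto
      moreover have "\<bar>\<theta>' t\<bar> * norm (K *v ?Z t) \<le> C * (R * (CZ * ?E t))"
        using C R(2)[of "?Z t"] mult_left_mono[OF Z R(1)] t(2)
        by (intro mult_mono) auto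
      ultimately have "norm (\<theta> t *\<^sub>R (K *v ?Z' t)) + norm (\<theta>' t *\<^sub>R (K *v ?Z t)) \<le> B * ?E t"
        by (simp add: B_def distrib_right mult.assoc)
      then show ?thesis
        using False norm_triangle_ineq[of "\<theta> t *\<^sub>R (K *v ?Z' t)" "\<theta>' t *\<^sub>R (K *v ?Z t)"]
        by (simp add: u'_def)
    qed
    show "\<exists>u'. \<forall>t\<in>{- D..T}. (u has_vector_derivative u' t) (at t within {- D..}) \<and> norm (u' t) \<le> B * ?E t"
      using deriv bound by (intro exI[of _ u']) auto
  qed
qed

text \<open>The Artstein transformation is undone by subtracting its integral. On the window
  \<open>t - s - D\<close> lies in \<open>{- D..0}\<close>, so the kernel is bounded, and
  \<open>envelope_shift\<close> replaces past values of the envelope by the present one.\<close>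

lemma modal_bound:
  obtains C where "C \<ge> 0"
    "\<And>X0 d X u T b t. \<lbrakk>run X0 d X u; b \<ge> 0; \<And>t. t \<in> {0..T} \<Longrightarrow> norm (d t) \<le> b; t \<in> {0..T}\<rbrakk>
      \<Longrightarrow> norm (modal (X t)) \<le> C * envelope \<kappa> (norm X0) b t"
proof -
  obtain CU where CU: "CU \<ge> 0" "\<And>X0 d X u T b t. \<lbrakk>run X0 d X u; b \<ge> 0;
      \<And>t. t \<in> {0..T} \<Longrightarrow> norm (d t) \<le> b; t \<in> {- D..T}\<rbrakk>
      \<Longrightarrow> norm (u t) \<le> CU * envelope \<kappa> (norm X0) b t"
    by (fact u_bound)
  obtain R where R: "R \<ge> 0" "\<And>v. norm (BN *v v) \<le> R * norm v"
    using bounded_linear_norm_bound[OF bounded_linear_matrix_vector] by blast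
  define E where "E = (\<Sum>i\<in>UNIV. exp (D * norm (lam (idx i))))"
  have E: "E \<ge> 0" unfolding E_def by (intro sum_nonneg) auto
  have kernel: "norm ((matexp (r *\<^sub>R AN) ** BN) *v v) \<le> E * (R * norm v)" if r: "\<bar>r\<bar> \<le> D" for r v
  proof -
    have "norm ((matexp (r *\<^sub>R AN) ** BN) *v v) \<le> (\<Sum>i\<in>UNIV. norm (((matexp (r *\<^sub>R AN) ** BN) *v v) $ i))"
      unfolding norm_vec_def by (rule L2_set_le_sum) simp
    also have "\<dots> \<le> (\<Sum>i\<in>UNIV. exp (D * norm (lam (idx i))) * (R * norm v))"
    proof (rule sum_mono)
      fix i :: 'n
      have "norm (exp (r *\<^sub>R lam (idx i))) \<le> exp (norm (r *\<^sub>R lam (idx i)))" by (rule norm_exp)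
      also have "\<dots> \<le> exp (D * norm (lam (idx i)))" using r by (simp add: mult_right_mono)
      finally have "norm (exp (r *\<^sub>R lam (idx i))) \<le> exp (D * norm (lam (idx i)))" .
      moreover have "norm ((BN *v v) $ i) \<le> R * norm v"
        by (rule order_trans[OF Finite_Cartesian_Product.norm_nth_le R(2)])
      ultimately show "norm (((matexp (r *\<^sub>R AN) ** BN) *v v) $ i) \<le> exp (D * norm (lam (idx i))) * (R * norm v)"
        unfolding AN matexp_A_trunc norm_mult by (intro mult_mono) auto
    qed
    finally show ?thesis by (simp add: E_def sum_distrib_right)
  qed
  define c where "c = E * (R * (CU * exp (\<kappa> * D)))"
  have c: "c \<ge> 0" using E R CU by (simp add: c_def)
  show thesis
  proof (rule that[of "CZ + c * D"])
    fix X0 d X u T b t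
    assume run: "run X0 d X u" and b: "b \<ge> 0" and d: "\<And>t. t \<in> {0..T} \<Longrightarrow> norm (d t) \<le> b"
      and t: "t \<in> {0..T}"
    let ?E = "envelope \<kappa> (norm X0) b"
    have E0: "?E t \<ge> 0" using b by (simp add: envelope_nonneg)
    let ?f = "\<lambda>s. (matexp ((t - s - D) *\<^sub>R AN) ** BN) *v u s"
    let ?m = "max (t - D) 0"
    have f: "norm (?f s) \<le> c * ?E t" if s: "s \<in> {?m..t}" for s
    proof -
      have "norm (u s) \<le> CU * ?E s"
        using s t D by (intro CU(2)[OF run b d]) auto
      also have "\<dots> \<le> CU * (exp (\<kappa> * D) * ?E t)"
        using s \<kappa> b by (intro mult_left_mono CU envelope_shift) auto
      finally have "E * (R * norm (u s)) \<le> E * (R * (CU * (exp (\<kappa> * D) * ?E t)))"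
        by (intro mult_left_mono E R)
      moreover have "norm (?f s) \<le> E * (R * norm (u s))" using s by (intro kernel) auto
      ultimately show ?thesis by (simp add: c_def mult.assoc)
    qed
    have "norm (integral {?m..t} ?f) \<le> c * ?E t * measure lborel (cbox ?m t)"
      using kernel_integrable[OF run, of t] t f c E0
      by (intro has_integral_bound[where f = ?f]) (auto simp: integrable_integral)
    also have "\<dots> \<le> c * ?E t * D" using t D c E0 by (intro mult_left_mono) auto
    finally have "norm (integral {?m..t} ?f) \<le> c * D * ?E t" by (simp add: mult_ac)
    moreover have "norm (artstein X u t) \<le> CZ * ?E t" by (rule Z_bound[OF run b d t])
    moreover have "modal (X t) = artstein X u t - integral {?m..t} ?f" by (simp add: artstein_def)
    ultimately show "norm (modal (X t)) \<le> (CZ + c * D) * ?E t"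
      using norm_triangle_ineq4[of "artstein X u t" "integral {?m..t} ?f"] by (simp add: distrib_right)
  qed (use CZ c D in simp)
qed

text \<open>After subtracting \<open>L (u (t - D))\<close> the forcing of mode \<open>n\<close> is
  the \<open>n\<close>-th coordinate of a single vector \<open>F\<close>, so all modes together are
  forced by at most a multiple of the norm of \<open>F\<close>. The finitely many possibly unstable
  modes come from \<open>modal_bound\<close> instead.\<close>

lemma state_bound:
  obtains C where "C \<ge> 0"
    "\<And>X0 d X u T b t. \<lbrakk>run X0 d X u; b \<ge> 0; \<And>t. t \<in> {0..T} \<Longrightarrow> norm (d t) \<le> b; t \<in> {0..T}\<rbrakk>
      \<Longrightarrow> norm (X t) \<le> C * envelope \<kappa> (norm X0) b t"
proof -
  obtain CU where CU: "CU \<ge> 0" "\<And>X0 d X u T b t. \<lbrakk>run X0 d X u; b \<ge> 0;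
      \<And>t. t \<in> {0..T} \<Longrightarrow> norm (d t) \<le> b; t \<in> {- D..T}\<rbrakk>
      \<Longrightarrow> norm (u t) \<le> CU * envelope \<kappa> (norm X0) b t"
    by (fact u_bound)
  obtain CV where CV: "CV \<ge> 0" "\<And>X0 d X u T b. \<lbrakk>run X0 d X u; b \<ge> 0; \<And>t. t \<in> {0..T} \<Longrightarrow> norm (d t) \<le> b\<rbrakk>
      \<Longrightarrow> \<exists>u'. \<forall>t\<in>{- D..T}. (u has_vector_derivative u' t) (at t within {- D..}) \<and>
        norm (u' t) \<le> CV * envelope \<kappa> (norm X0) b t"
    by (fact u_derivative_bound)
  obtain CY where CY: "CY \<ge> 0" "\<And>X0 d X u T b t. \<lbrakk>run X0 d X u; b \<ge> 0;
      \<And>t. t \<in> {0..T} \<Longrightarrow> norm (d t) \<le> b; t \<in> {0..T}\<rbrakk>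
      \<Longrightarrow> norm (modal (X t)) \<le> CY * envelope \<kappa> (norm X0) b t"
    by (fact modal_bound)
  obtain P where P: "P \<ge> 0" "\<And>x. norm (modal x) \<le> P * norm x"
    using bounded_linear_norm_bound[OF bounded_linear_modal] by blast
  obtain l where l: "l \<ge> 0" "\<And>v. norm (L v) \<le> l * norm v"
    using bounded_linear_norm_bound[OF lift(1)] by blast
  obtain al where al: "al \<ge> 0" "\<And>v. norm (A (L v)) \<le> al * norm v"
    using bounded_linear_norm_bound[OF lift(2)] by blast
  obtain CR where CR: "CR > 0"
    "\<And>x N. (\<Sum>n=1..N. (norm (ip x (\<psi> n)))\<^sup>2) \<le> CR * (norm x)\<^sup>2"
    "\<And>x B. (\<And>N. (\<Sum>n=1..N. (norm (ip x (\<psi> n)))\<^sup>2) \<le> B) \<Longrightarrow> (norm x)\<^sup>2 \<le> CR * B"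
    using riesz_bounds by blast
  define e where "e = exp (\<kappa> * D)"
  have e: "e \<ge> 0" by (simp add: e_def)
  \<comment> \<open>\<open>CF\<close> collects the three terms of \<open>F\<close>. In
    \<open>c\<close>, the 1 covers the initial value, \<open>CF\<close> the forcing, and
    \<open>sqrt CR\<close> the passage from norms to coordinates. \<open>CM\<close> is for the first
    \<open>N0\<close> modes, and \<open>CW\<close> recombines them with the damped ones.\<close>
  define CF where "CF = al * (CU * e) + 1 + l * (CV * e)"
  define c where "c = sqrt CR * (1 + CF)"
  define CM where "CM = CY + P * (l * (CU * e))"
  define CW where "CW = sqrt (CR * (CM\<^sup>2 + (1 + 1 / \<kappa>)\<^sup>2 * c\<^sup>2))"
  have CF: "CF \<ge> 0" and c: "c \<ge> 0" and CM: "CM \<ge> 0" and CW: "CW \<ge> 0"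
    using al l CU CV CY P CR e by (auto simp: CF_def c_def CM_def CW_def)
  show thesis
  proof (rule that[of "CW + l * (CU * e)"])
    fix X0 d X u T b t
    assume run: "run X0 d X u" and b: "b \<ge> 0" and d: "\<And>t. t \<in> {0..T} \<Longrightarrow> norm (d t) \<le> b"
      and t: "t \<in> {0..T}"
    let ?E = "envelope \<kappa> (norm X0) b"
    have E0: "?E s \<ge> 0" for s using b by (simp add: envelope_nonneg)
    obtain u' where u': "\<And>t. t \<in> {- D..T} \<Longrightarrow> (u has_vector_derivative u' t) (at t within {- D..})"
      "\<And>t. t \<in> {- D..T} \<Longrightarrow> norm (u' t) \<le> CV * ?E t"
      using CV(2)[OF run b d] by blast
    define W where "W t = X t - L (u (t - D))" for t
    define F where "F t = A (L (u (t - D))) + d t - L (u' (t - D))" for t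
    have delay: "?E (s - D) \<le> e * ?E s" for s
      unfolding e_def using \<kappa> b D by (intro envelope_shift) auto
    have uD: "norm (u (s - D)) \<le> CU * e * ?E s" if "s \<in> {0..T}" for s
    proof -
      have "norm (u (s - D)) \<le> CU * ?E (s - D)" using that D by (intro CU(2)[OF run b d]) auto
      then show ?thesis using mult_left_mono[OF delay[of s] CU(1)] by (simp add: mult.assoc)
    qed
    have LuD: "norm (L (u (s - D))) \<le> l * (CU * e) * ?E s" if "s \<in> {0..T}" for s
      using l(2)[of "u (s - D)"] mult_left_mono[OF uD[OF that] l(1)] by (simp add: mult.assoc)
    have F: "norm (F s) \<le> CF * ?E s" if s: "s \<in> {0..T}" for s
    proof -
      have "norm (A (L (u (s - D)))) \<le> al * (CU * e) * ?E s"
        using al(2)[of "u (s - D)"] mult_left_mono[OF uD[OF s] al(1)] by (simp add: mult.assoc)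
      moreover have "norm (d s) \<le> 1 * ?E s" using d[OF s] b by (simp add: envelope_def add_increasing)
      moreover have "norm (u' (s - D)) \<le> CV * (e * ?E s)"
        using u'(2)[of "s - D"] s D mult_left_mono[OF delay[of s] CV(1)] by auto
      then have "norm (L (u' (s - D))) \<le> l * (CV * e) * ?E s"
        using order_trans[OF l(2) mult_left_mono[OF _ l(1)]] by (simp add: mult.assoc)
      ultimately have "norm (A (L (u (s - D)))) + norm (d s) + norm (L (u' (s - D))) \<le> CF * ?E s"
        by (simp add: CF_def distrib_right)
      then show ?thesis
        unfolding F_def
        using norm_triangle_ineq4[of "A (L (u (s - D))) + d s" "L (u' (s - D))"]
          norm_triangle_ineq[of "A (L (u (s - D)))" "d s"] by linarith
    qed
    define z where "z n t = to_complex (ip (W t) (\<psi> n))" for n t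
    define f where "f n t = to_complex (ip (F t) (\<psi> n))" for n t
    have z': "(z n has_vector_derivative to_complex (lam n) * z n s + f n s) (at s within {0..T})"
      if n: "n \<ge> 1" and s: "s \<in> {0..T}" for n s
    proof -
      have "((\<lambda>t. ip (X t) (\<psi> n) - ip (L (u (t - D))) (\<psi> n)) has_vector_derivative
        (lam n * ip (X s) (\<psi> n) + (- lam n * ip (L (u (s - D))) (\<psi> n) + ip (A (L (u (s - D)))) (\<psi> n)) + ip (d s) (\<psi> n))
        - ip (L (u' (s - D))) (\<psi> n)) (at s within {0..})"
        by (intro has_vector_derivative_diff coordinate_derivative[OF run]
            bounded_linear.has_vector_derivative[OF bounded_linear_ip]
            bounded_linear.has_vector_derivative[OF lift(1)]
            has_vector_derivative_shift u'(1)) (use s n D in auto)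
      then have "((\<lambda>t. ip (W t) (\<psi> n)) has_vector_derivative lam n * ip (W s) (\<psi> n) + ip (F s) (\<psi> n)) (at s within {0..})"
        by (simp add: W_def F_def ip_add_left linear_diff[OF ip_linear] algebra_simps)
      from bounded_linear.has_vector_derivative[OF bounded_linear_to_complex this]
      have "(z n has_vector_derivative to_complex (lam n) * z n s + f n s) (at s within {0..})"
        by (simp add: z_def[abs_def] f_def to_complex_add to_complex_mult)
      then show ?thesis by (rule has_vector_derivative_within_subset) auto
    qed
    \<comment> \<open>The sum of squares is estimated as one function, since bounds for single modes
      could not be summed over \<open>n\<close>. It is finite, so it can be differentiated termwise,
      and the bound does not depend on \<open>N\<close>.\<close>
    have tail: "(\<Sum>n=N0+1..N. (norm (z n t))\<^sup>2) \<le> (1 + 1 / \<kappa>)\<^sup>2 * (envelope \<kappa> (c * norm X0) (c * b) t)\<^sup>2" for N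
    proof (rule square_decay[OF \<kappa>(1) _ _ _ _ _ t])
      fix s assume s: "s \<in> {0..T}"
      let ?v' = "\<lambda>n. 2 * (z n s \<bullet> (to_complex (lam n) * z n s + f n s))"
      show "((\<lambda>t. \<Sum>n=N0+1..N. (norm (z n t))\<^sup>2) has_real_derivative (\<Sum>n=N0+1..N. ?v' n)) (at s within {0..T})"
        by (intro DERIV_sum norm_square_has_derivative z' s) auto
      have "?v' n \<le> - 3 * \<kappa> * (norm (z n s))\<^sup>2 + (norm (f n s))\<^sup>2 / \<kappa>" if n: "n \<ge> N0 + 1" for n
      proof -
        have "z n s \<bullet> (to_complex (lam n) * z n s) = Re (to_complex (lam n)) * (norm (z n s))\<^sup>2"
          unfolding cmod_power2 by (simp add: inner_complex_def power2_eq_square algebra_simps)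
        also have "\<dots> \<le> (- 2 * \<kappa>) * (norm (z n s))\<^sup>2"
          using A2(2) n \<kappa>(2) by (intro mult_right_mono) force+
        finally show ?thesis
          using norm_cauchy_schwarz[of "z n s" "f n s"]
            two_mult_le_scaled_squares[OF \<kappa>(1), of "norm (z n s)" "norm (f n s)"]
          by (simp add: inner_add_right)
      qed
      then have "(\<Sum>n=N0+1..N. ?v' n) \<le> (\<Sum>n=N0+1..N. - 3 * \<kappa> * (norm (z n s))\<^sup>2 + (norm (f n s))\<^sup>2 / \<kappa>)"
        by (intro sum_mono) auto
      also have "\<dots> = - 3 * \<kappa> * (\<Sum>n=N0+1..N. (norm (z n s))\<^sup>2) + (\<Sum>n=N0+1..N. (norm (f n s))\<^sup>2) / \<kappa>"
        by (simp only: sum.distrib sum_distrib_left sum_divide_distrib)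
      also have "(\<Sum>n=N0+1..N. (norm (f n s))\<^sup>2) \<le> (envelope \<kappa> (c * norm X0) (c * b) s)\<^sup>2"
      proof -
        have "(\<Sum>n=N0+1..N. (norm (f n s))\<^sup>2) \<le> (\<Sum>n=1..N. (norm (ip (F s) (\<psi> n)))\<^sup>2)"
          unfolding f_def norm_to_complex by (rule sum_mono2) auto
        also have "\<dots> \<le> CR * (norm (F s))\<^sup>2" by (rule CR)
        also have "\<dots> = (sqrt CR * norm (F s))\<^sup>2" using CR(1) by (simp add: power_mult_distrib)
        also have "\<dots> \<le> (envelope \<kappa> (c * norm X0) (c * b) s)\<^sup>2"
        proof (rule power_mono)
          have "sqrt CR * norm (F s) \<le> sqrt CR * (CF * ?E s)" using F[OF s] CR(1) by (intro mult_left_mono) auto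
          also have "\<dots> \<le> c * ?E s" using E0[of s] CR(1) by (simp add: c_def algebra_simps)
          finally show "sqrt CR * norm (F s) \<le> envelope \<kappa> (c * norm X0) (c * b) s" by (simp add: envelope_scale)
        qed (use CR(1) in simp)
        finally show ?thesis .
      qed
      finally show "(\<Sum>n=N0+1..N. ?v' n) \<le> - 3 * \<kappa> * (\<Sum>n=N0+1..N. (norm (z n s))\<^sup>2)
          + (envelope \<kappa> (c * norm X0) (c * b) s)\<^sup>2 / \<kappa>"
        using \<kappa>(1) by (simp add: divide_right_mono)
    next
      \<comment> \<open>The delayed input at time 0 is \<open>u (- D) = 0\<close>.\<close>
      have "W 0 = X0"
        using u_0[OF run, of "- D"] D X_props(5)[OF run] linear_0[OF bounded_linear.linear[OF lift(1)]]
        by (simp add: W_def)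
      have "(\<Sum>n=N0+1..N. (norm (z n 0))\<^sup>2) \<le> (\<Sum>n=1..N. (norm (ip X0 (\<psi> n)))\<^sup>2)"
        unfolding z_def norm_to_complex \<open>W 0 = X0\<close> by (rule sum_mono2) auto
      also have "\<dots> \<le> CR * (norm X0)\<^sup>2" by (rule CR)
      also have "\<dots> = (sqrt CR * norm X0)\<^sup>2" using CR(1) by (simp add: power_mult_distrib)
      also have "\<dots> \<le> (c * norm X0 + c * b)\<^sup>2"
      proof (rule power_mono)
        have "sqrt CR * 1 \<le> c" unfolding c_def using CR(1) CF by (intro mult_left_mono) auto
        then have "sqrt CR * norm X0 \<le> c * norm X0" by (intro mult_right_mono) auto
        then show "sqrt CR * norm X0 \<le> c * norm X0 + c * b" using c b by (simp add: add_increasing2)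
      qed (use CR(1) in simp)
      finally show "(\<Sum>n=N0+1..N. (norm (z n 0))\<^sup>2) \<le> (c * norm X0 + c * b)\<^sup>2" .
    qed (use c b in auto)
    have head: "(\<Sum>n=1..N0. (norm (z n t))\<^sup>2) \<le> CM\<^sup>2 * (?E t)\<^sup>2"
    proof -
      have "(\<Sum>n=1..N0. (norm (z n t))\<^sup>2) = (\<Sum>i\<in>UNIV. (norm (z (idx i) t))\<^sup>2)"
        by (rule sum.reindex_bij_betw[OF idx, symmetric])
      also have "\<dots> = (norm (modal (W t)))\<^sup>2"
        by (simp add: norm_vec_def L2_set_def sum_nonneg modal_vector_def z_def norm_to_complex)
      also have "\<dots> \<le> (CM * ?E t)\<^sup>2"
      proof (rule power_mono)
        have "norm (modal (W t)) \<le> norm (modal (X t)) + norm (modal (L (u (t - D))))"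
          unfolding W_def linear_diff[OF bounded_linear.linear[OF bounded_linear_modal]] by (rule norm_triangle_ineq4)
        moreover have "norm (modal (L (u (t - D)))) \<le> P * (l * (CU * e) * ?E t)"
          using P(2)[of "L (u (t - D))"] mult_left_mono[OF LuD[OF t] P(1)] by linarith
        moreover have "norm (modal (X t)) \<le> CY * ?E t" by (rule CY(2)[OF run b d t])
        ultimately show "norm (modal (W t)) \<le> CM * ?E t" by (simp add: CM_def distrib_right mult.assoc)
      qed simp
      finally show ?thesis by (simp add: power_mult_distrib)
    qed
    have "(\<Sum>n=1..N. (norm (ip (W t) (\<psi> n)))\<^sup>2) \<le> (CM\<^sup>2 + (1 + 1 / \<kappa>)\<^sup>2 * c\<^sup>2) * (?E t)\<^sup>2" for N
    proof -
      \<comment> \<open>An inequality, because for \<open>N < N0\<close> the index set on the right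
        is larger.\<close>
      have "(\<Sum>n=1..N. (norm (ip (W t) (\<psi> n)))\<^sup>2) \<le> (\<Sum>n\<in>{1..N0} \<union> {N0+1..N}. (norm (z n t))\<^sup>2)"
        unfolding z_def norm_to_complex by (rule sum_mono2) auto
      also have "\<dots> = (\<Sum>n=1..N0. (norm (z n t))\<^sup>2) + (\<Sum>n=N0+1..N. (norm (z n t))\<^sup>2)"
        by (rule sum.union_disjoint) auto
      also have "\<dots> \<le> CM\<^sup>2 * (?E t)\<^sup>2 + (1 + 1 / \<kappa>)\<^sup>2 * (envelope \<kappa> (c * norm X0) (c * b) t)\<^sup>2"
        by (intro add_mono head tail)
      finally show ?thesis by (simp add: envelope_scale power_mult_distrib distrib_right mult.assoc)
    qed
    then have "(norm (W t))\<^sup>2 \<le> CR * ((CM\<^sup>2 + (1 + 1 / \<kappa>)\<^sup>2 * c\<^sup>2) * (?E t)\<^sup>2)" by (rule CR(3))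
    also have "\<dots> = (CW * ?E t)\<^sup>2"
      using CR(1) by (simp add: CW_def power_mult_distrib mult.assoc)
    finally have "norm (W t) \<le> CW * ?E t"
      by (rule power2_le_imp_le) (use CW E0 in simp)
    moreover have "norm (X t) \<le> norm (W t) + norm (L (u (t - D)))"
      using norm_triangle_ineq[of "W t" "L (u (t - D))"] by (simp add: W_def)
    ultimately show "norm (X t) \<le> (CW + l * (CU * e)) * ?E t"
      using LuD[OF t] by (simp add: distrib_right)
  qed (use CW l CU e in simp)
qed

end

section \<open>Assembly of the estimates\<close>

theorem closed_loop_input_to_state_stable:
  obtains \<kappa> C1 C2 where "\<kappa> > 0" "C1 \<ge> 0" "C2 \<ge> 0"
    "\<And>X0 d X u t. \<lbrakk>continuous_on {0..} d;
      closed_loop_solution idx ip DA A Bd \<psi> AN BN D \<theta> K X0 d X u; t \<ge> 0\<rbrakk> \<Longrightarrow>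
      norm (X t) \<le> C1 * exp (- \<kappa> * t) * norm X0 + C1 * (SUP \<tau>\<in>{0..t}. norm (d \<tau>)) \<and>
      norm (u t) \<le> C2 * exp (- \<kappa> * t) * norm X0 + C2 * (SUP \<tau>\<in>{0..t}. norm (d \<tau>))"
proof -
  obtain \<kappa> CZ where \<kappa>: "\<kappa> > 0" "2 * \<kappa> \<le> \<alpha>" "CZ \<ge> 0" "artstein_controlled \<kappa> CZ"
    by (fact artstein_bound)
  obtain C1 where C1: "C1 \<ge> 0" "\<And>X0 d X u T b t. \<lbrakk>run X0 d X u; b \<ge> 0;
      \<And>t. t \<in> {0..T} \<Longrightarrow> norm (d t) \<le> b; t \<in> {0..T}\<rbrakk>
      \<Longrightarrow> norm (X t) \<le> C1 * envelope \<kappa> (norm X0) b t"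
    by (fact state_bound[OF \<kappa>])
  obtain C3 where C3: "C3 \<ge> 0" "\<And>X0 d X u T b t. \<lbrakk>run X0 d X u; b \<ge> 0;
      \<And>t. t \<in> {0..T} \<Longrightarrow> norm (d t) \<le> b; t \<in> {- D..T}\<rbrakk>
      \<Longrightarrow> norm (u t) \<le> C3 * envelope \<kappa> (norm X0) b t"
    by (fact u_bound[OF \<kappa>])
  show thesis
  proof (rule that[OF \<kappa>(1) C1(1) C3(1)], intro conjI)
    fix X0 d X u t
    assume d: "continuous_on {0..} d" and t: "t \<ge> (0::real)"
      and "closed_loop_solution idx ip DA A Bd \<psi> AN BN D \<theta> K X0 d X u"
    then have run: "run X0 d X u" by (simp add: run_def)
    let ?b = "SUP \<tau>\<in>{0..t}. norm (d \<tau>)"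
    \<comment> \<open>Continuity makes the disturbance bounded on \<open>{0..t}\<close>, without
      which the real \<open>SUP\<close> would not be an upper bound.\<close>
    have "compact ((\<lambda>\<tau>. norm (d \<tau>)) ` {0..t})"
      by (intro compact_continuous_image continuous_intros continuous_on_subset[OF d]) auto
    then have "bdd_above ((\<lambda>\<tau>. norm (d \<tau>)) ` {0..t})"
      by (intro bounded_imp_bdd_above compact_imp_bounded)
    then have b: "norm (d \<tau>) \<le> ?b" if "\<tau> \<in> {0..t}" for \<tau> using that by (rule cSUP_upper[rotated])
    have b0: "?b \<ge> 0" using t by (intro order_trans[OF norm_ge_zero b[of 0]]) simp
    have "norm (X t) \<le> C1 * envelope \<kappa> (norm X0) ?b t"
      by (rule C1(2)[OF run b0 b]) (use t in auto)
    then show "norm (X t) \<le> C1 * exp (- \<kappa> * t) * norm X0 + C1 * ?b"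
      by (simp add: envelope_def algebra_simps)
    have "norm (u t) \<le> C3 * envelope \<kappa> (norm X0) ?b t"
      by (rule C3(2)[OF run b0 b]) (use t D in auto)
    then show "norm (u t) \<le> C3 * exp (- \<kappa> * t) * norm X0 + C3 * ?b"
      by (simp add: envelope_def algebra_simps)
  qed
qed

end

theorem mainTheorem1:
  fixes scl :: "'k::real_or_complex \<Rightarrow> 'h::{banach,second_countable_topology} \<Rightarrow> 'h"
    and ip :: "'h \<Rightarrow> 'h \<Rightarrow> 'k"
    and DA DB :: "'h set"
    and A :: "'h \<Rightarrow> 'h"
    and Bd :: "'h \<Rightarrow> 'k^'m"
    and L :: "'k^'m \<Rightarrow> 'h"
    and lam :: "nat \<Rightarrow> 'k"
    and \<phi> \<psi> :: "nat \<Rightarrow> 'h"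
    and N0 :: nat
    and idx :: "'n::finite \<Rightarrow> nat"
    and \<alpha> D t0 :: real
    and \<theta> :: "real \<Rightarrow> real"
    and K :: "'k^'n^'m"
    and AN :: "'k^'n^'n"
    and BN :: "'k^'m^'n"
  assumes hilbert: "separable_hilbert_space scl ip"
    and bcs: "boundary_control_system scl DA A DB Bd"
    and lifting: "lifting_operator scl DA A Bd L"
    and A1: "riesz_spectral_operator scl (dom0 DA DB Bd) A lam \<phi>"
    and biorth: "biorthogonal ip \<phi> \<psi>"
    and N0: "N0 \<ge> 1"
    and idx: "bij_betw idx UNIV {1..N0}"
    and A2: "\<alpha> > 0" "\<forall>n\<ge>N0 + 1. Re (to_complex (lam n)) \<le> - \<alpha>"
    and AN: "AN = A_trunc idx lam"
    and BN: "BN = B_trunc idx ip A L lam \<psi>"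
    and A3: "kalman_condition idx AN BN"
    and D: "D > 0"
    and t0: "t0 > 0"
    and \<theta>: "transition_signal D t0 \<theta>"
    and K: "hurwitz (AN + matexp ((- D) *\<^sub>R AN) ** BN ** K)"
  shows "\<exists>\<kappa>0 C1 C2 C3 C4. \<kappa>0 > 0 \<and> C1 \<ge> 0 \<and> C2 \<ge> 0 \<and> C3 \<ge> 0 \<and> C4 \<ge> 0 \<and>
    (\<forall>X0 \<in> dom0 DA DB Bd. \<forall>d. C1_on {0..} d \<longrightarrow>
      (\<forall>X u. closed_loop_solution idx ip DA A Bd \<psi> AN BN D \<theta> K X0 d X u \<longrightarrow>
        (\<forall>t\<ge>0.
          norm (X t) \<le> C1 * exp (- \<kappa>0 * t) * norm X0 + C2 * (SUP \<tau>\<in>{0..t}. norm (d \<tau>)) \<and>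
          norm (u t) \<le> C3 * exp (- \<kappa>0 * t) * norm X0 + C4 * (SUP \<tau>\<in>{0..t}. norm (d \<tau>)))))"
proof -
  have "riesz_basis scl \<phi>" using A1 by (simp add: riesz_spectral_operator_def)
  interpret delay_feedback scl ip \<phi> \<psi> DA DB A Bd L lam N0 idx \<alpha> D t0 \<theta> K AN BN
    by unfold_locales
      (rule \<open>riesz_basis scl \<phi>\<close> hilbert biorth bcs lifting A1 idx A2 AN BN D t0 \<theta> K)+
  obtain \<kappa> C1 C2 where C: "\<kappa> > 0" "C1 \<ge> 0" "C2 \<ge> 0"
    "\<And>X0 d X u t. \<lbrakk>continuous_on {0..} d;
      closed_loop_solution idx ip DA A Bd \<psi> AN BN D \<theta> K X0 d X u; t \<ge> 0\<rbrakk> \<Longrightarrow>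
      norm (X t) \<le> C1 * exp (- \<kappa> * t) * norm X0 + C1 * (SUP \<tau>\<in>{0..t}. norm (d \<tau>)) \<and>
      norm (u t) \<le> C2 * exp (- \<kappa> * t) * norm X0 + C2 * (SUP \<tau>\<in>{0..t}. norm (d \<tau>))"
    by (fact closed_loop_input_to_state_stable)
  have cont: "continuous_on {0..} d" if "C1_on {0..} d" for d :: "real \<Rightarrow> 'h"
    using that by (auto simp: C1_on_def intro: continuous_on_vector_derivative)
  \<comment> \<open>One constant serves both summands of each estimate, since the envelope weighs
    them alike.\<close>
  show ?thesis
    by (rule exI[of _ \<kappa>], rule exI[of _ C1], rule exI[of _ C1], rule exI[of _ C2], rule exI[of _ C2])
      (intro conjI ballI allI impI C(1-3) C(4)[THEN conjunct1] C(4)[THEN conjunct2] cont)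
qed

end
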